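(* Let $0<q<1$, $\alpha\in\mathbb{R}\setminus[-1,1]$, $\lambda>0$, $j\in\mathbb{N}$, and let $\{\mathbb{H}_n(x;q)\}_{n\ge 0}$ be the sequence of $q$-Hermite I-Sobolev type polynomials. Then $$\overline{\mathcal{R}}_n(x)\,D_{q^{-1}}D_q\mathbb{H}_n(x;q)+\overline{\mathcal{S}}_n(x)\,D_{q^{-1}}\mathbb{H}_n(x;q)+\overline{\mathcal{T}}_n(x)\,\mathbb{H}_n(x;q)=0,\qquad n\ge 0,$$ where $$\overline{\mathcal{R}}_n(x)=\mathcal{R}_n(q^{-1}x),\qquad \overline{\mathcal{S}}_n(x)=\mathcal{S}_n(q^{-1}x)+(q^{-1}-1)\,x\,\mathcal{T}_n(q^{-1}x),\qquad \overline{\mathcal{T}}_n(x)=\mathcal{T}_n(q^{-1}x),$$ and $$\mathcal{R}_n=\mathcal{F}_{4,n}\,\Xi_{1,n},\qquad \mathcal{S}_n=-\mathcal{F}_{6,n}\,\Xi_{1,n},\qquad \mathcal{T}_n=\mathcal{E}_{4,n}\mathcal{F}_{6,n}-\mathcal{E}_{6,n}\mathcal{F}_{4,n}.$$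
   Context: Here $\mathbb{N}=\{0,1,2,\dots\}$ and $0<q<1$. Notation: $[n]_q=\frac{1-q^n}{1-q}$ for $n\in\mathbb{Z}$, $[0]_q!=1$, $[n]_q!=[n]_q\cdots[1]_q$; $(a;q)_n=\prod_{i=0}^{n-1}(1-aq^i)$ (also for $n=\infty$), $(a_1,\dots,a_r;q)_n=\prod_i(a_i;q)_n$; $[n]_q^{(k)}=\frac{(q^{-n};q)_k}{(q-1)^k}q^{kn-\binom{k}{2}}$. The $q$-derivative is $D_qf(x)=\frac{f(qx)-f(x)}{(q-1)x}$ for $x\ne0$ (and $f'(0)$ at $x=0$), and $D_{q^{-1}}$ is the same operator with $q$ replaced by $q^{-1}$, i.e. $D_{q^{-1}}f(x)=\frac{f(q^{-1}x)-f(x)}{(q^{-1}-1)x}$; $D_q^0f=f$, $D_q^k=D_q D_q^{k-1}$. The $q$-subtraction power is $(x\boxminus_q y)^m=\sum_{k=0}^m\frac{[m]_q!}{[k]_q![m-k]_q!}q^{\binom{k}{2}}(-y)^kx^{m-k}$. Monic $q$-Hermite I polynomials: $H_n(x;q)=q^{\binom n2}\sum_{k=0}^n\frac{(q^{-n};q)_k(x^{-1};q)_k}{(q;q)_k}(-qx)^k$ for $n\ge0$, and $H_m=0$ for $m<0$; they satisfy $xH_n=H_{n+1}+\gamma_nH_{n-1}$ with $\gamma_n=q^{n-1}(1-q^n)$. Put $\|H_n\|^2=(1-q)(q;q)_n(q,-1,-q;q)_\infty q^{\binom n2}$ and $K_{n,q}^{(i,l)}(x,y)=\sum_{k=0}^n\frac{(D_q^iH_k)(x;q)\,(D_q^lH_k)(y;q)}{\|H_k\|^2}$.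 Sobolev-type inner product: $\langle f,g\rangle_\lambda=\int_{-1}^1f(x)g(x)(qx,-qx;q)_\infty d_qx+\lambda (D_q^jf)(\alpha)(D_q^jg)(\alpha)$, where $\int_{-1}^1h(t)d_qt=(1-q)\sum_{m\ge0}q^m\big(h(q^m)+h(-q^m)\big)$. The $q$-Hermite I-Sobolev type polynomial $\mathbb{H}_n(x;q)$ is the monic polynomial of degree $n$ in the sequence orthogonal with respect to $\langle\cdot,\cdot\rangle_\lambda$. With $\mathcal{E}_{1,n},\mathcal{F}_{1,n}$ as below, wherever $\mathcal{F}_{1,n}\not\equiv0$ it has the hypergeometric representation $$\mathbb{H}_n(x;q)=-\frac{\mathcal{F}_{1,n}(x)(1-\psi_n(x)q^{-1})q^{\binom n2-n+2}}{[n]_q\psi_n(x)(1-q)}\sum_{k\ge0}\frac{(q^{-n},x^{-1},\psi_n(x);q)_k}{(\psi_n(x)q^{-1};q)_k\,(q;q)_k}(-qx)^k,$$ with $\psi_n=((1-q)\vartheta_n+1)^{-1}$, $\vartheta_n=-\frac{q^{n-2}[n]_q\mathcal{E}_{1,n}}{\mathcal{F}_{1,n}}-[n-1]_q$. Put $\mathcal{A}_n^{(j)}(x,y)=\frac{[j]_q!}{\|H_{n-1}\|^2(x\boxminus_qy)^{j+1}}\sum_{k=0}^j\frac{(D_q^kH_{n-1})(y;q)}{[k]_q!}(x\boxminus_qy)^k$, $\mathcal{B}_n^{(j)}(x,y)=-\frac{[j]_q!}{\|H_{n-1}\|^2(x\boxminus_qy)^{j+1}}\sum_{k=0}^j\frac{(D_q^kH_{n})(y;q)}{[k]_q!}(x\boxminus_qy)^k$.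 With $D_q$ acting on $x$: $\mathcal{C}_{1,n}(x,y)=D_q\mathcal{A}_n^{(j)}(x,y)-[n-1]_q\gamma_{n-1}^{-1}\mathcal{B}_n^{(j)}(qx,y)$, $\mathcal{D}_{1,n}(x,y)=[n]_q\mathcal{A}_n^{(j)}(qx,y)+[n-1]_q\gamma_{n-1}^{-1}x\,\mathcal{B}_n^{(j)}(qx,y)+D_q\mathcal{B}_n^{(j)}(x,y)$, $\mathcal{C}_{2,n}(x,y)=D_q\mathcal{C}_{1,n}(x,y)-[n-1]_q\gamma_{n-1}^{-1}\mathcal{D}_{1,n}(qx,y)$, $\mathcal{D}_{2,n}(x,y)=[n]_q\mathcal{C}_{1,n}(qx,y)+[n-1]_q\gamma_{n-1}^{-1}x\,\mathcal{D}_{1,n}(qx,y)+D_q\mathcal{D}_{1,n}(x,y)$. With $c_n=\lambda\frac{[n]_q^{(j)}H_{n-j}(\alpha;q)}{1+\lambda K_{n-1,q}^{(j,j)}(\alpha,\alpha)}$: $\mathcal{E}_{1,n}(x)=1-c_n\mathcal{A}_n^{(j)}(x,\alpha)$, $\mathcal{F}_{1,n}(x)=-c_n\mathcal{B}_n^{(j)}(x,\alpha)$; $\mathcal{E}_{2,n}(x)=-\mathcal{F}_{1,n-1}(x)/\gamma_{n-1}$, $\mathcal{F}_{2,n}(x)=\mathcal{E}_{1,n-1}(x)-x\mathcal{E}_{2,n}(x)$; $\mathcal{E}_{3,n}(x)=-c_n\mathcal{C}_{1,n}(x,\alpha)$, $\mathcal{F}_{3,n}(x)=[n]_q-c_n\mathcal{D}_{1,n}(x,\alpha)$;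 $\mathcal{E}_{5,n}(x)=-[n]_q^{(2)}\gamma_{n-1}^{-1}-c_n\mathcal{C}_{2,n}(x,\alpha)$, $\mathcal{F}_{5,n}(x)=[n]_q^{(2)}\gamma_{n-1}^{-1}x-c_n\mathcal{D}_{2,n}(x,\alpha)$; $\Xi_{1,n}=\mathcal{E}_{1,n}\mathcal{F}_{2,n}-\mathcal{E}_{2,n}\mathcal{F}_{1,n}$; $\mathcal{E}_{4,n}=-(\mathcal{E}_{2,n}\mathcal{F}_{3,n}-\mathcal{E}_{3,n}\mathcal{F}_{2,n})$, $\mathcal{F}_{4,n}=\mathcal{E}_{1,n}\mathcal{F}_{3,n}-\mathcal{E}_{3,n}\mathcal{F}_{1,n}$; $\mathcal{E}_{6,n}=-(\mathcal{E}_{2,n}\mathcal{F}_{5,n}-\mathcal{E}_{5,n}\mathcal{F}_{2,n})$, $\mathcal{F}_{6,n}=\mathcal{E}_{1,n}\mathcal{F}_{5,n}-\mathcal{E}_{5,n}\mathcal{F}_{1,n}$. *)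

theory Defs
  imports "HOL-Analysis.Analysis" "HOL-Computational_Algebra.Polynomial"
begin

section \<open>Basic q-calculus\<close>

definition qnum :: "real \<Rightarrow> int \<Rightarrow> real" where
  "qnum q n = (1 - q powi n) / (1 - q)"

definition qfact :: "real \<Rightarrow> nat \<Rightarrow> real" where
  "qfact q n = (\<Prod>k=1..n. qnum q (int k))"

definition qpoch :: "real \<Rightarrow> real \<Rightarrow> nat \<Rightarrow> real" where
  "qpoch a q n = (\<Prod>i<n. 1 - a * q ^ i)"

definition qpoch_inf :: "real \<Rightarrow> real \<Rightarrow> real" where
  "qpoch_inf a q = (\<Prod>i. 1 - a * q ^ i)"

text \<open>The number written \<open>[n]\<^sub>q\<close> with upper index \<open>(k)\<close>.\<close>

definition qfall :: "real \<Rightarrow> int \<Rightarrow> nat \<Rightarrow> real" where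
  "qfall q n k = qpoch (q powi (- n)) q k / (q - 1) ^ k * q powi (int k * n - int (k choose 2))"

definition qderiv :: "real \<Rightarrow> (real \<Rightarrow> real) \<Rightarrow> real \<Rightarrow> real" where
  "qderiv q f x = (if x = 0 then deriv f 0 else (f (q * x) - f x) / ((q - 1) * x))"

definition qsub_power :: "real \<Rightarrow> real \<Rightarrow> real \<Rightarrow> nat \<Rightarrow> real" where
  "qsub_power q x y m =
     (\<Sum>k\<le>m. qfact q m / (qfact q k * qfact q (m - k)) * q ^ (k choose 2) * (- y) ^ k * x ^ (m - k))"

definition jackson_integral :: "real \<Rightarrow> (real \<Rightarrow> real) \<Rightarrow> real" where
  "jackson_integral q h = (1 - q) * (\<Sum>m. q ^ m * (h (q ^ m) + h (- (q ^ m))))"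


section \<open>The monic q-Hermite I polynomials\<close>

text \<open>
  The factor \<open>(x\<^sup>-\<^sup>1; q)\<^sub>k (- q x)\<^sup>k\<close> of the defining sum is a polynomial in \<open>x\<close>,
  namely \<open>(- q)\<^sup>k (x - 1) (x - q) \<dots> (x - q\<^sup>k\<^sup>-\<^sup>1)\<close>.  It is written in this form because
  the total inverse with \<open>inverse 0 = 0\<close> would give a wrong value at \<open>x = 0\<close>.
\<close>

definition qHermite :: "real \<Rightarrow> int \<Rightarrow> real poly" where
  "qHermite q n =
     (if n < 0 then 0
      else smult (q ^ (nat n choose 2))
             (\<Sum>k\<le>nat n. smult (qpoch (q powi (- n)) q k / qpoch q q k * (- q) ^ k)
                            (\<Prod>i<k. [:- (q ^ i), 1:])))"

definition qH_gamma :: "real \<Rightarrow> int \<Rightarrow> real" where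
  "qH_gamma q n = q powi (n - 1) * (1 - q powi n)"

text \<open>
  For \<open>n < 0\<close> the polynomial is zero, and so is its squared norm.  A quotient by
  this norm is then \<open>0\<close>, in agreement with the usual convention
  \<open>1 / (q; q)\<^sub>n = 0\<close> for negative \<open>n\<close>.
\<close>

definition qH_norm2 :: "real \<Rightarrow> int \<Rightarrow> real" where
  "qH_norm2 q n =
     (if n < 0 then 0
      else (1 - q) * qpoch q q (nat n) *
           (qpoch_inf q q * qpoch_inf (-1) q * qpoch_inf (- q) q) * q ^ (nat n choose 2))"

definition qH_kernel :: "real \<Rightarrow> nat \<Rightarrow> nat \<Rightarrow> int \<Rightarrow> real \<Rightarrow> real \<Rightarrow> real" where
  "qH_kernel q i l n x y =
     (\<Sum>k\<in>{0..n}. (qderiv q ^^ i) (poly (qHermite q k)) x *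
                   (qderiv q ^^ l) (poly (qHermite q k)) y / qH_norm2 q k)"


section \<open>The Sobolev-type inner product and its monic orthogonal polynomials\<close>

definition sobolev_ip ::
    "real \<Rightarrow> real \<Rightarrow> real \<Rightarrow> nat \<Rightarrow> (real \<Rightarrow> real) \<Rightarrow> (real \<Rightarrow> real) \<Rightarrow> real" where
  "sobolev_ip q \<alpha> lam j f g =
     jackson_integral q (\<lambda>x. f x * g x * (qpoch_inf (q * x) q * qpoch_inf (- (q * x)) q))
     + lam * (qderiv q ^^ j) f \<alpha> * (qderiv q ^^ j) g \<alpha>"

definition qH_Sobolev_seq :: "real \<Rightarrow> real \<Rightarrow> real \<Rightarrow> nat \<Rightarrow> (nat \<Rightarrow> real poly) \<Rightarrow> bool" where
  "qH_Sobolev_seq q \<alpha> lam j P \<longleftrightarrow>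
     (\<forall>n. degree (P n) = n \<and> lead_coeff (P n) = 1) \<and>
     (\<forall>m n. m \<noteq> n \<longrightarrow> sobolev_ip q \<alpha> lam j (poly (P m)) (poly (P n)) = 0)"


section \<open>Coefficient functions\<close>

text \<open>
  The index \<open>n\<close> is an integer, since the coefficients of index \<open>n\<close> refer to objects of index
  \<open>n - 1\<close> and \<open>n - 2\<close>.  Quotients by \<open>qH_gamma q (n - 1)\<close> are of the form \<open>0 / 0\<close> for \<open>n = 1\<close>
  and then have the value \<open>0\<close>.
\<close>

definition qH_A :: "real \<Rightarrow> nat \<Rightarrow> int \<Rightarrow> real \<Rightarrow> real \<Rightarrow> real" where
  "qH_A q j n x y =
     qfact q j / (qH_norm2 q (n - 1) * qsub_power q x y (j + 1)) *
     (\<Sum>k\<le>j. (qderiv q ^^ k) (poly (qHermite q (n - 1))) y / qfact q k * qsub_power q x y k)"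

definition qH_B :: "real \<Rightarrow> nat \<Rightarrow> int \<Rightarrow> real \<Rightarrow> real \<Rightarrow> real" where
  "qH_B q j n x y =
     - (qfact q j / (qH_norm2 q (n - 1) * qsub_power q x y (j + 1))) *
     (\<Sum>k\<le>j. (qderiv q ^^ k) (poly (qHermite q n)) y / qfact q k * qsub_power q x y k)"

definition qH_C1 :: "real \<Rightarrow> nat \<Rightarrow> int \<Rightarrow> real \<Rightarrow> real \<Rightarrow> real" where
  "qH_C1 q j n x y =
     qderiv q (\<lambda>t. qH_A q j n t y) x
     - qnum q (n - 1) / qH_gamma q (n - 1) * qH_B q j n (q * x) y"

definition qH_D1 :: "real \<Rightarrow> nat \<Rightarrow> int \<Rightarrow> real \<Rightarrow> real \<Rightarrow> real" where
  "qH_D1 q j n x y =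
     qnum q n * qH_A q j n (q * x) y
     + qnum q (n - 1) / qH_gamma q (n - 1) * x * qH_B q j n (q * x) y
     + qderiv q (\<lambda>t. qH_B q j n t y) x"

definition qH_C2 :: "real \<Rightarrow> nat \<Rightarrow> int \<Rightarrow> real \<Rightarrow> real \<Rightarrow> real" where
  "qH_C2 q j n x y =
     qderiv q (\<lambda>t. qH_C1 q j n t y) x
     - qnum q (n - 1) / qH_gamma q (n - 1) * qH_D1 q j n (q * x) y"

definition qH_D2 :: "real \<Rightarrow> nat \<Rightarrow> int \<Rightarrow> real \<Rightarrow> real \<Rightarrow> real" where
  "qH_D2 q j n x y =
     qnum q n * qH_C1 q j n (q * x) y
     + qnum q (n - 1) / qH_gamma q (n - 1) * x * qH_D1 q j n (q * x) y
     + qderiv q (\<lambda>t. qH_D1 q j n t y) x"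

definition qH_c :: "real \<Rightarrow> real \<Rightarrow> real \<Rightarrow> nat \<Rightarrow> int \<Rightarrow> real" where
  "qH_c q \<alpha> lam j n =
     lam * (qfall q n j * poly (qHermite q (n - int j)) \<alpha> / (1 + lam * qH_kernel q j j (n - 1) \<alpha> \<alpha>))"

definition qH_E1 :: "real \<Rightarrow> real \<Rightarrow> real \<Rightarrow> nat \<Rightarrow> int \<Rightarrow> real \<Rightarrow> real" where
  "qH_E1 q \<alpha> lam j n x = 1 - qH_c q \<alpha> lam j n * qH_A q j n x \<alpha>"

definition qH_F1 :: "real \<Rightarrow> real \<Rightarrow> real \<Rightarrow> nat \<Rightarrow> int \<Rightarrow> real \<Rightarrow> real" where
  "qH_F1 q \<alpha> lam j n x = - qH_c q \<alpha> lam j n * qH_B q j n x \<alpha>"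

definition qH_E2 :: "real \<Rightarrow> real \<Rightarrow> real \<Rightarrow> nat \<Rightarrow> int \<Rightarrow> real \<Rightarrow> real" where
  "qH_E2 q \<alpha> lam j n x = - qH_F1 q \<alpha> lam j (n - 1) x / qH_gamma q (n - 1)"

definition qH_F2 :: "real \<Rightarrow> real \<Rightarrow> real \<Rightarrow> nat \<Rightarrow> int \<Rightarrow> real \<Rightarrow> real" where
  "qH_F2 q \<alpha> lam j n x = qH_E1 q \<alpha> lam j (n - 1) x - x * qH_E2 q \<alpha> lam j n x"

definition qH_E3 :: "real \<Rightarrow> real \<Rightarrow> real \<Rightarrow> nat \<Rightarrow> int \<Rightarrow> real \<Rightarrow> real" where
  "qH_E3 q \<alpha> lam j n x = - qH_c q \<alpha> lam j n * qH_C1 q j n x \<alpha>"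

definition qH_F3 :: "real \<Rightarrow> real \<Rightarrow> real \<Rightarrow> nat \<Rightarrow> int \<Rightarrow> real \<Rightarrow> real" where
  "qH_F3 q \<alpha> lam j n x = qnum q n - qH_c q \<alpha> lam j n * qH_D1 q j n x \<alpha>"

definition qH_E5 :: "real \<Rightarrow> real \<Rightarrow> real \<Rightarrow> nat \<Rightarrow> int \<Rightarrow> real \<Rightarrow> real" where
  "qH_E5 q \<alpha> lam j n x =
     - (qfall q n 2 / qH_gamma q (n - 1)) - qH_c q \<alpha> lam j n * qH_C2 q j n x \<alpha>"

definition qH_F5 :: "real \<Rightarrow> real \<Rightarrow> real \<Rightarrow> nat \<Rightarrow> int \<Rightarrow> real \<Rightarrow> real" where
  "qH_F5 q \<alpha> lam j n x =
     qfall q n 2 / qH_gamma q (n - 1) * x - qH_c q \<alpha> lam j n * qH_D2 q j n x \<alpha>"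

definition qH_Xi1 :: "real \<Rightarrow> real \<Rightarrow> real \<Rightarrow> nat \<Rightarrow> int \<Rightarrow> real \<Rightarrow> real" where
  "qH_Xi1 q \<alpha> lam j n x =
     qH_E1 q \<alpha> lam j n x * qH_F2 q \<alpha> lam j n x - qH_E2 q \<alpha> lam j n x * qH_F1 q \<alpha> lam j n x"

definition qH_E4 :: "real \<Rightarrow> real \<Rightarrow> real \<Rightarrow> nat \<Rightarrow> int \<Rightarrow> real \<Rightarrow> real" where
  "qH_E4 q \<alpha> lam j n x =
     - (qH_E2 q \<alpha> lam j n x * qH_F3 q \<alpha> lam j n x - qH_E3 q \<alpha> lam j n x * qH_F2 q \<alpha> lam j n x)"

definition qH_F4 :: "real \<Rightarrow> real \<Rightarrow> real \<Rightarrow> nat \<Rightarrow> int \<Rightarrow> real \<Rightarrow> real" where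
  "qH_F4 q \<alpha> lam j n x =
     qH_E1 q \<alpha> lam j n x * qH_F3 q \<alpha> lam j n x - qH_E3 q \<alpha> lam j n x * qH_F1 q \<alpha> lam j n x"

definition qH_E6 :: "real \<Rightarrow> real \<Rightarrow> real \<Rightarrow> nat \<Rightarrow> int \<Rightarrow> real \<Rightarrow> real" where
  "qH_E6 q \<alpha> lam j n x =
     - (qH_E2 q \<alpha> lam j n x * qH_F5 q \<alpha> lam j n x - qH_E5 q \<alpha> lam j n x * qH_F2 q \<alpha> lam j n x)"

definition qH_F6 :: "real \<Rightarrow> real \<Rightarrow> real \<Rightarrow> nat \<Rightarrow> int \<Rightarrow> real \<Rightarrow> real" where
  "qH_F6 q \<alpha> lam j n x =
     qH_E1 q \<alpha> lam j n x * qH_F5 q \<alpha> lam j n x - qH_E5 q \<alpha> lam j n x * qH_F1 q \<alpha> lam j n x"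

definition qH_R :: "real \<Rightarrow> real \<Rightarrow> real \<Rightarrow> nat \<Rightarrow> int \<Rightarrow> real \<Rightarrow> real" where
  "qH_R q \<alpha> lam j n x = qH_F4 q \<alpha> lam j n x * qH_Xi1 q \<alpha> lam j n x"

definition qH_S :: "real \<Rightarrow> real \<Rightarrow> real \<Rightarrow> nat \<Rightarrow> int \<Rightarrow> real \<Rightarrow> real" where
  "qH_S q \<alpha> lam j n x = - qH_F6 q \<alpha> lam j n x * qH_Xi1 q \<alpha> lam j n x"

definition qH_T :: "real \<Rightarrow> real \<Rightarrow> real \<Rightarrow> nat \<Rightarrow> int \<Rightarrow> real \<Rightarrow> real" where
  "qH_T q \<alpha> lam j n x =
     qH_E4 q \<alpha> lam j n x * qH_F6 q \<alpha> lam j n x - qH_E6 q \<alpha> lam j n x * qH_F4 q \<alpha> lam j n x"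

definition qH_Rbar :: "real \<Rightarrow> real \<Rightarrow> real \<Rightarrow> nat \<Rightarrow> int \<Rightarrow> real \<Rightarrow> real" where
  "qH_Rbar q \<alpha> lam j n x = qH_R q \<alpha> lam j n (inverse q * x)"

definition qH_Sbar :: "real \<Rightarrow> real \<Rightarrow> real \<Rightarrow> nat \<Rightarrow> int \<Rightarrow> real \<Rightarrow> real" where
  "qH_Sbar q \<alpha> lam j n x =
     qH_S q \<alpha> lam j n (inverse q * x) + (inverse q - 1) * x * qH_T q \<alpha> lam j n (inverse q * x)"

definition qH_Tbar :: "real \<Rightarrow> real \<Rightarrow> real \<Rightarrow> nat \<Rightarrow> int \<Rightarrow> real \<Rightarrow> real" where
  "qH_Tbar q \<alpha> lam j n x = qH_T q \<alpha> lam j n (inverse q * x)"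

text \<open>
  The rational functions \<open>qH_A\<close> and \<open>qH_B\<close> have the denominator
  \<open>qsub_power q x \<alpha> (j + 1) = (x - \<alpha>) (x - q \<alpha>) \<dots> (x - q\<^sup>j \<alpha>)\<close>.
  The barred coefficients at \<open>x\<close> evaluate them at \<open>inverse q * x\<close>, \<open>x\<close> and \<open>q * x\<close>.
\<close>

definition qH_regular :: "real \<Rightarrow> real \<Rightarrow> nat \<Rightarrow> real \<Rightarrow> bool" where
  "qH_regular q \<alpha> j x \<longleftrightarrow>
     (\<forall>t\<in>{inverse q * x, x, q * x}. qsub_power q t \<alpha> (j + 1) \<noteq> 0)"

end

theory Submission
  imports Defs
begin

text \<open>
  Put \<open>t = x / q\<close>.  For a polynomial \<open>f\<close> one has
  \<open>(D\<^sub>1\<^sub>/\<^sub>q f)(x) = (D\<^sub>q f)(t)\<close> and \<open>f(x) = f(t) + (q - 1) t (D\<^sub>q f)(t)\<close>.  Substituting this, the extra summand of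
  the second barred coefficient cancels, and the claim becomes the relation
  \<open>R D\<^sub>q\<^sup>2 P\<^sub>n + S D\<^sub>q P\<^sub>n + T P\<^sub>n = 0\<close> at \<open>t\<close>.  The three functions \<open>P\<^sub>n\<close>, \<open>D\<^sub>q P\<^sub>n\<close>, \<open>D\<^sub>q\<^sup>2 P\<^sub>n\<close> are all combinations of the same
  two polynomials \<open>H\<^sub>n\<close>, \<open>H\<^sub>n\<^sub>-\<^sub>1\<close>, with coefficient pairs \<open>(E\<^sub>1, F\<^sub>1)\<close>, \<open>(E\<^sub>3, F\<^sub>3)\<close>, \<open>(E\<^sub>5, F\<^sub>5)\<close>; hence they are
  linearly dependent, and \<open>R\<close>, \<open>S\<close>, \<open>T\<close> are the minors of that dependence times the common factor \<open>\<Xi>\<^sub>1\<close>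
  (\<open>second_order_elimination\<close>).

  The first of the three representations rests on two facts.  Orthogonality in the Sobolev product
  forces \<open>P\<^sub>n = H\<^sub>n - c\<^sub>n K(x, \<alpha>)\<close>, where \<open>K\<close> is the kernel of order \<open>n - 1\<close>, differentiated \<open>j\<close> times in its
  second variable (\<open>qH_Sobolev_connection\<close>).  And the Christoffel--Darboux formula, differentiated \<open>j\<close> times,
  gives \<open>K(x, y) = A(x, y) H\<^sub>n(x) + B(x, y) H\<^sub>n\<^sub>-\<^sub>1(x)\<close> (\<open>qH_kernel_representation\<close>).  The other two
  representations follow by applying the \<open>q\<close>-product rule once and twice (\<open>qderiv_Hermite_combination\<close>), with
  \<open>D\<^sub>q H\<^sub>n = [n]\<^sub>q H\<^sub>n\<^sub>-\<^sub>1\<close> and the three-term recurrence bringing every term back to \<open>H\<^sub>n\<close> and \<open>H\<^sub>n\<^sub>-\<^sub>1\<close>.  Each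
  application uses the representation at \<open>t\<close> and at \<open>q t\<close>, which is why regularity at \<open>t\<close>, \<open>q t\<close>, \<open>q\<^sup>2 t\<close> is required.

  The kernel needs the orthogonality of the \<open>H\<^sub>n\<close> with their exact norms.  Both come from a single
  integration by parts, \<open>\<integral> x p = (1 - q) \<integral> D\<^sub>q p\<close> (\<open>jackson_functional_X\<close>), together with the recurrence and the total
  mass of the weight (\<open>suminf_qweight\<close>).

  The point \<open>x = 0\<close> needs care: the \<open>q\<close>-derivative there is an ordinary derivative, and it is applied to
  \<open>C\<^sub>1\<close> and \<open>D\<^sub>1\<close>, which away from the origin are difference quotients.  That these are differentiable at the
  origin is seen from their being rational functions (\<open>rational_near_0_qderiv\<close>).
\<close>

section \<open>The q-derivative on polynomials\<close>

text \<open>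
  The numerator vanishes at the origin, so the division is exact and the \<open>q\<close>-derivative of a
  polynomial is again a polynomial; at the origin its value is the ordinary derivative.
\<close>

definition qdiff_poly :: "real \<Rightarrow> real poly \<Rightarrow> real poly" where
  "qdiff_poly q p = (pcompose p [:0, q:] - p) div [:0, q - 1:]"

lemma qdiff_poly_times:
  assumes "q \<noteq> 1"
  shows "[:0, q - 1:] * qdiff_poly q p = pcompose p [:0, q:] - p"
proof -
  have "poly (pcompose p [:0, q:] - p) 0 = 0" by (simp add: poly_pcompose)
  then have "[:0, 1:] dvd pcompose p [:0, q:] - p"
    using poly_eq_0_iff_dvd[of "pcompose p [:0, q:] - p" 0] by simp
  moreover have "[:0, q - 1:] = smult (q - 1) [:0, 1:]" by simp
  ultimately have "[:0, q - 1:] dvd pcompose p [:0, q:] - p"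
    using assms by (metis smult_dvd right_minus_eq)
  then show ?thesis unfolding qdiff_poly_def by (rule dvd_mult_div_cancel)
qed

text \<open>
  Algebraic rules for the operator are read off from this characterisation: multiply by
  \<open>(q - 1) x\<close> and compare.
\<close>

lemma qdiff_poly_unique:
  assumes "q \<noteq> 1" and "[:0, q - 1:] * r = pcompose p [:0, q:] - p"
  shows "qdiff_poly q p = r"
proof -
  have "[:0, q - 1:] * qdiff_poly q p = [:0, q - 1:] * r"
    using assms qdiff_poly_times by simp
  then show ?thesis using assms(1) by (simp del: mult_pCons_left)
qed

lemma poly_qdiff_poly:
  assumes "q \<noteq> 1"
  shows "(q - 1) * x * poly (qdiff_poly q p) x = poly p (q * x) - poly p x"
  using arg_cong[OF qdiff_poly_times[OF assms], of "\<lambda>r. poly r x" p]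
  by (simp add: poly_pcompose algebra_simps)

lemma qderiv_poly:
  assumes "q \<noteq> 1"
  shows "qderiv q (poly p) = poly (qdiff_poly q p)"
proof
  fix x
  show "qderiv q (poly p) x = poly (qdiff_poly q p) x"
  proof (cases "x = 0")
    case True
    have "poly (pderiv ([:0, q - 1:] * qdiff_poly q p)) 0
        = poly (pderiv (pcompose p [:0, q:] - p)) 0"
      using qdiff_poly_times[OF assms] by simp
    then have "(q - 1) * poly (qdiff_poly q p) 0 = (q - 1) * poly (pderiv p) 0"
      by (simp add: pderiv_mult pderiv_pcompose pderiv_diff pderiv_pCons poly_pcompose algebra_simps
               del: mult_pCons_left)
    then show ?thesis using True assms DERIV_imp_deriv[OF poly_DERIV[of p 0]] by (simp add: qderiv_def)
  next
    case False
    then show ?thesis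
      using poly_qdiff_poly[OF assms, of x p] assms by (simp add: qderiv_def field_simps)
  qed
qed

lemma qderiv_iterate_poly:
  assumes "q \<noteq> 1"
  shows "(qderiv q ^^ k) (poly p) = poly ((qdiff_poly q ^^ k) p)"
  by (induction k) (simp_all add: qderiv_poly[OF assms])

lemma qdiff_poly_add:
  "q \<noteq> 1 \<Longrightarrow> qdiff_poly q (p + r) = qdiff_poly q p + qdiff_poly q r"
  by (rule qdiff_poly_unique)
     (simp_all add: qdiff_poly_times pcompose_add distrib_left del: mult_pCons_left)

lemma qdiff_poly_smult:
  "q \<noteq> 1 \<Longrightarrow> qdiff_poly q (smult c p) = smult c (qdiff_poly q p)"
  by (rule qdiff_poly_unique)
     (simp_all add: qdiff_poly_times pcompose_smult smult_diff_right del: mult_pCons_left)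

lemma qdiff_poly_iterate_add:
  "q \<noteq> 1 \<Longrightarrow> (qdiff_poly q ^^ k) (p + r) = (qdiff_poly q ^^ k) p + (qdiff_poly q ^^ k) r"
  by (induction k) (simp_all add: qdiff_poly_add)

lemma qdiff_poly_iterate_smult:
  "q \<noteq> 1 \<Longrightarrow> (qdiff_poly q ^^ k) (smult c p) = smult c ((qdiff_poly q ^^ k) p)"
  by (induction k) (simp_all add: qdiff_poly_smult)

lemma qdiff_poly_iterate_0: "q \<noteq> 1 \<Longrightarrow> (qdiff_poly q ^^ k) 0 = 0"
  using qdiff_poly_iterate_smult[of q k 0 0] by simp

lemma qdiff_poly_iterate_sum:
  "q \<noteq> 1 \<Longrightarrow> (qdiff_poly q ^^ k) (\<Sum>i\<in>I. f i) = (\<Sum>i\<in>I. (qdiff_poly q ^^ k) (f i))"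
  by (induction I rule: infinite_finite_induct)
     (simp_all add: qdiff_poly_iterate_add qdiff_poly_iterate_0)

lemma qdiff_poly_sum:
  "q \<noteq> 1 \<Longrightarrow> qdiff_poly q (\<Sum>i\<in>I. f i) = (\<Sum>i\<in>I. qdiff_poly q (f i))"
  using qdiff_poly_iterate_sum[of q 1] by simp

lemma qdiff_poly_mult:
  assumes "q \<noteq> 1"
  shows "qdiff_poly q (p * r) = pcompose p [:0, q:] * qdiff_poly q r + qdiff_poly q p * r"
proof (rule qdiff_poly_unique[OF assms])
  have "[:0, q - 1:] * (pcompose p [:0, q:] * qdiff_poly q r + qdiff_poly q p * r)
      = pcompose p [:0, q:] * ([:0, q - 1:] * qdiff_poly q r) + ([:0, q - 1:] * qdiff_poly q p) * r"
    by (simp only: algebra_simps)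
  also have "\<dots> = pcompose (p * r) [:0, q:] - p * r"
    unfolding qdiff_poly_times[OF assms] pcompose_mult by (simp only: algebra_simps)
  finally show "[:0, q - 1:] * (pcompose p [:0, q:] * qdiff_poly q r + qdiff_poly q p * r)
      = pcompose (p * r) [:0, q:] - p * r" .
qed

lemma qdiff_poly_const: "q \<noteq> 1 \<Longrightarrow> qdiff_poly q [:c:] = 0"
  by (rule qdiff_poly_unique) auto

section \<open>Lowering relation and three-term recurrence\<close>

text \<open>
  These are the coefficients of \<open>H\<^sub>n\<close> in the Newton basis
  \<open>(x - 1) (x - q) \<dots> (x - q\<^sup>k\<^sup>-\<^sup>1)\<close>: a Gaussian binomial times a power of \<open>q\<close>.
  Extending them by \<open>0\<close> for \<open>k > n\<close> lets sums over different ranges be compared termwise.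
\<close>

definition qHermite_coeff :: "real \<Rightarrow> nat \<Rightarrow> nat \<Rightarrow> real" where
  "qHermite_coeff q n k =
     (if k \<le> n then qpoch q q n / (qpoch q q k * qpoch q q (n - k)) * q ^ ((n - k) choose 2) else 0)"

definition qnewton :: "real \<Rightarrow> nat \<Rightarrow> real poly" where
  "qnewton q k = (\<Prod>i<k. [:- (q ^ i), 1:])"

lemma choose2_Suc: "Suc m choose 2 = (m choose 2) + m"
  by (simp add: numeral_2_eq_2)

lemma smult_sum_distrib: "smult (c :: real) (\<Sum>k\<in>I. f k) = (\<Sum>k\<in>I. smult c (f k))"
  by (induction I rule: infinite_finite_induct) (simp_all add: smult_add_right)

lemma qpoch_Suc: "qpoch a q (Suc n) = qpoch a q n * (1 - a * q ^ n)"
  by (simp add: qpoch_def)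

lemma qnum_of_nat: "qnum q (int n) = (1 - q ^ n) / (1 - q)"
  by (simp add: qnum_def)

lemma qfact_Suc: "qfact q (Suc n) = qfact q n * qnum q (int (Suc n))"
  by (simp add: qfact_def)

lemma qHermite_coeff_0: "k > n \<Longrightarrow> qHermite_coeff q n k = 0"
  by (simp add: qHermite_coeff_def)

lemma poly_qnewton: "poly (qnewton q k) x = (\<Prod>i<k. x - q ^ i)"
  by (simp add: qnewton_def poly_prod)

locale q_base =
  fixes q :: real
  assumes q_pos: "0 < q" and q_less: "q < 1"

context q_base
begin

lemma q_neq1: "q \<noteq> 1" using q_less by simp

lemma qpow_less_1: "q ^ Suc i < 1"
  using q_pos q_less by (intro power_Suc_less_one) auto

lemma qpoch_q_pos: "qpoch q q n > 0"
proof -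
  have "1 - q * q ^ i > 0" for i using qpow_less_1[of i] by simp
  then show ?thesis unfolding qpoch_def by (intro prod_pos) auto
qed

text \<open>
  The negative powers of \<open>q\<close> in \<open>(q\<^sup>-\<^sup>n; q)\<^sub>k\<close>, with \<open>n = k + m\<close>, cancel against the prefactors of
  the definition of \<open>H\<^sub>n\<close>; what remains is a quotient of positive \<open>q\<close>-factorials.
\<close>

lemma qpoch_neg_power:
  "qpoch (q powi (- int (k + m))) q k * (- q) ^ k * q ^ ((k + m) choose 2) * qpoch q q m
     = qpoch q q (k + m) * q ^ (m choose 2)"
proof (induction k arbitrary: m)
  case 0
  then show ?case by (simp add: qpoch_def)
next
  case (Suc k)
  have IH: "qpoch (q powi (- int (k + Suc m))) q k * (- q) ^ k * q ^ ((k + Suc m) choose 2) * qpoch q q (Suc m)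
     = qpoch q q (k + Suc m) * q ^ (Suc m choose 2)" by (rule Suc)
  have e: "(1 - q powi (- int (k + Suc m)) * q ^ k) * (- q) * q ^ m = 1 - q ^ Suc m"
  proof -
    have "q powi (- int (k + Suc m)) * q ^ k = inverse (q ^ Suc m)"
      using q_pos unfolding power_int_minus power_int_of_nat by (simp add: power_add field_simps)
    then show ?thesis using q_pos by (simp add: field_simps)
  qed
  have "qpoch (q powi (- int (Suc k + m))) q (Suc k) * (- q) ^ Suc k * q ^ ((Suc k + m) choose 2) * qpoch q q m * q ^ m
     = (qpoch (q powi (- int (k + Suc m))) q k * (- q) ^ k * q ^ ((k + Suc m) choose 2) * qpoch q q m) *
       ((1 - q powi (- int (k + Suc m)) * q ^ k) * (- q) * q ^ m)"
    by (simp only: qpoch_Suc power_Suc add_Suc add_Suc_right mult_ac)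
  also have "\<dots> = qpoch (q powi (- int (k + Suc m))) q k * (- q) ^ k * q ^ ((k + Suc m) choose 2) * qpoch q q (Suc m)"
    unfolding e by (simp add: qpoch_Suc)
  also have "\<dots> = qpoch q q (Suc k + m) * q ^ (m choose 2) * q ^ m"
    unfolding IH by (simp add: choose2_Suc power_add)
  finally have "(qpoch (q powi (- int (Suc k + m))) q (Suc k) * (- q) ^ Suc k * q ^ ((Suc k + m) choose 2) * qpoch q q m) * q ^ m
     = (qpoch q q (Suc k + m) * q ^ (m choose 2)) * q ^ m" .
  then show ?case using q_pos by (metis mult_right_cancel power_not_zero less_irrefl)
qed

text \<open>
  The defining sum with its coefficients brought to the form without negative powers of \<open>q\<close>.
\<close>

lemma qHermite_newton:
  "qHermite q (int n) = (\<Sum>k\<le>n. smult (qHermite_coeff q n k) (qnewton q k))"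
proof -
  have "q ^ (n choose 2) * (qpoch (q powi (- int n)) q k / qpoch q q k * (- q) ^ k) = qHermite_coeff q n k"
    if k: "k \<le> n" for k
  proof -
    obtain m where n: "n = k + m" using k le_iff_add by blast
    show ?thesis
      using qpoch_neg_power[of k m] qpoch_q_pos[of k] qpoch_q_pos[of m]
      by (simp add: n qHermite_coeff_def field_simps)
  qed
  then show ?thesis
    by (auto simp: qHermite_def smult_sum_distrib qnewton_def intro!: sum.cong)
qed

lemma qHermite_coeff_lower:
  "(1 - q ^ Suc k) * qHermite_coeff q (Suc n) (Suc k) = (1 - q ^ Suc n) * qHermite_coeff q n k"
  using qpoch_q_pos[of k]  qpoch_q_pos[of "n - k"] qpow_less_1[of k]
  by (auto simp: qHermite_coeff_def qpoch_Suc field_simps)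

lemma qHermite_coeff_recurrence_0:
  "qHermite_coeff q (Suc n) 0 =
     qHermite_coeff q (Suc (Suc n)) 0 + q ^ n * (1 - q ^ Suc n) * qHermite_coeff q n 0"
proof -
  have "qHermite_coeff q n 0 = q ^ (n choose 2)" for n
    using qpoch_q_pos[of n] by (simp add: qHermite_coeff_def qpoch_def[of q q 0])
  then show ?thesis
    by (simp add: choose2_Suc power_add algebra_simps)
qed

text \<open>
  Comparing coefficients of the Newton basis in \<open>x H\<^sub>n\<^sub>+\<^sub>1 = H\<^sub>n\<^sub>+\<^sub>2 + \<gamma>\<^sub>n\<^sub>+\<^sub>1 H\<^sub>n\<close> gives this identity,
  which combines the \<open>q\<close>-Pascal rule with the rule that lowers the upper index of a Gaussian
  binomial.  The cases \<open>k \<ge> n\<close>, where some of the coefficients vanish, are treated separately.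
\<close>

lemma qHermite_coeff_recurrence_Suc:
  "qHermite_coeff q (Suc n) k + q ^ Suc k * qHermite_coeff q (Suc n) (Suc k) =
     qHermite_coeff q (Suc (Suc n)) (Suc k) + q ^ n * (1 - q ^ Suc n) * qHermite_coeff q n (Suc k)"
proof -
  consider "k < n" | "k = n" | "k = Suc n" | "k > Suc n" by linarith
  then show ?thesis
  proof cases
    case 1
    then obtain m where n: "n = Suc k + m" using less_iff_Suc_add by auto
    have [simp]: "k + m - k = m" "Suc (k + m) - k = Suc m" "Suc (Suc (k + m)) - k = Suc (Suc m)" by auto
    define a b N g x y where "a = qpoch q q k" and "b = qpoch q q m" and "N = qpoch q q n"
      and "g = q ^ (m choose 2)" and "x = q ^ k" and "y = q ^ m"
    note ds = a_def b_def N_def g_def x_def y_def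
    have ne: "a \<noteq> 0" "b \<noteq> 0" "1 - q * x \<noteq> 0" "1 - q * y \<noteq> 0" "1 - q * (q * y) \<noteq> 0"
      using qpoch_q_pos[of k] qpoch_q_pos[of m] qpow_less_1[of k] qpow_less_1[of m]
        qpow_less_1[of "Suc m"]
      by (auto simp: ds)
    have qn: "q ^ n = q * x * y" by (simp add: n ds power_add)
    have 1: "qHermite_coeff q (Suc n) k =
        N * (1 - q * (q * x * y)) / (a * (b * (1 - q * y) * (1 - q * (q * y)))) * (g * y * (q * y))"
      unfolding qn[symmetric] unfolding ds
      by (simp add: qHermite_coeff_def qpoch_Suc choose2_Suc power_add n)
    have 2: "qHermite_coeff q (Suc n) (Suc k) =
        N * (1 - q * (q * x * y)) / (a * (1 - q * x) * (b * (1 - q * y))) * (g * y)"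
      unfolding qn[symmetric] unfolding ds
      by (simp add: qHermite_coeff_def qpoch_Suc choose2_Suc power_add n)
    have 3: "qHermite_coeff q (Suc (Suc n)) (Suc k) =
        N * (1 - q * (q * x * y)) * (1 - q * (q * (q * x * y)))
          / (a * (1 - q * x) * (b * (1 - q * y) * (1 - q * (q * y)))) * (g * y * (q * y))"
      unfolding qn[symmetric] unfolding ds
      by (simp add: qHermite_coeff_def qpoch_Suc choose2_Suc power_add n)
    have 4: "qHermite_coeff q n (Suc k) = N / (a * (1 - q * x) * b) * g"
      unfolding ds by (simp add: qHermite_coeff_def qpoch_Suc n)
    have 5: "N * (1 - q * (q * x * y)) / (a * (b * (1 - q * y) * (1 - q * (q * y)))) * (g * y * (q * y))
        + (q * x) * (N * (1 - q * (q * x * y)) / (a * (1 - q * x) * (b * (1 - q * y))) * (g * y))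
      = N * (1 - q * (q * x * y)) * (1 - q * (q * (q * x * y)))
          / (a * (1 - q * x) * (b * (1 - q * y) * (1 - q * (q * y)))) * (g * y * (q * y))
        + (q * x * y) * (1 - q * (q * x * y)) * (N / (a * (1 - q * x) * b) * g)"
      using ne by (simp add: divide_simps) algebra
    show ?thesis
      unfolding 1 2 3 4 power_Suc qn x_def[symmetric] by (rule 5)
  next
    case 2
    have q1: "qpoch q q (Suc 0) = 1 - q" by (simp add: qpoch_def)
    have "qHermite_coeff q (Suc n) n = (1 - q ^ Suc n) / (1 - q)"
      "qHermite_coeff q (Suc n) (Suc n) = 1"
      "qHermite_coeff q (Suc (Suc n)) (Suc n) = (1 - q ^ Suc (Suc n)) / (1 - q)"
      using qpoch_q_pos[of n] qpow_less_1[of n]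
      by (simp_all add: qHermite_coeff_def Suc_diff_le q1 qpoch_Suc numeral_2_eq_2 qpoch_def[of q q 0])
    note c = this
    have "(1 - q ^ Suc n) / (1 - q) + q ^ Suc n * 1
        = (1 - q ^ Suc (Suc n)) / (1 - q) + q ^ n * (1 - q ^ Suc n) * 0"
      using q_less by (simp add: field_simps)
    then show ?thesis unfolding 2 c qHermite_coeff_0[of n "Suc n", OF lessI] .
  next
    case 3
    show ?thesis
      using qpoch_q_pos[of "Suc n"] qpoch_q_pos[of "Suc (Suc n)"]
      by (simp add: 3 qHermite_coeff_def qpoch_def[of q q 0])
  next
    case 4
    then show ?thesis by (simp add: qHermite_coeff_def)
  qed
qed

lemma qnewton_times_X: "[:0, 1:] * qnewton q k = qnewton q (Suc k) + smult (q ^ k) (qnewton q k)"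
proof -
  have "[:0, 1:] = [:- (q ^ k), 1:] + [:q ^ k:]" by simp
  then have "[:0, 1:] * qnewton q k = ([:- (q ^ k), 1:] + [:q ^ k:]) * qnewton q k" by (rule arg_cong)
  then show ?thesis
    by (simp only: distrib_right qnewton_def prod.lessThan_Suc mult.commute) simp
qed

lemma qHermite_newton_upto:
  assumes "n \<le> N"
  shows "qHermite q (int n) = (\<Sum>k\<le>N. smult (qHermite_coeff q n k) (qnewton q k))"
  unfolding qHermite_newton
  using assms by (intro sum.mono_neutral_left) (auto simp: qHermite_coeff_0)

text \<open>
  Multiplication by \<open>x\<close> is bidiagonal in the Newton basis, so the recurrence reduces to the
  coefficient identities above.
\<close>

theorem qHermite_three_term:
  "[:0, 1:] * qHermite q (int (Suc n)) =
     qHermite q (int (Suc (Suc n))) + smult (q ^ n * (1 - q ^ Suc n)) (qHermite q (int n))"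
proof -
  let ?c = "\<lambda>m k. qHermite_coeff q m k" and ?\<phi> = "qnewton q"
  have "[:0, 1:] * qHermite q (int (Suc n)) =
      (\<Sum>k\<le>Suc n. smult (?c (Suc n) k) ([:0, 1:] * ?\<phi> k))"
    unfolding qHermite_newton sum_distrib_left mult_smult_right ..
  also have "\<dots> = (\<Sum>k\<le>Suc n. smult (?c (Suc n) k) (?\<phi> (Suc k)))
      + (\<Sum>k\<le>Suc (Suc n). smult (q ^ k * ?c (Suc n) k) (?\<phi> k))"
    unfolding qnewton_times_X smult_add_right sum.distrib
    by (simp add: qHermite_coeff_0 mult.commute)
  also have "\<dots> = smult (?c (Suc n) 0) (?\<phi> 0)
      + (\<Sum>k\<le>Suc n. smult (?c (Suc n) k + q ^ Suc k * ?c (Suc n) (Suc k)) (?\<phi> (Suc k)))"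
    unfolding sum.atMost_Suc_shift[of _ "Suc n"] smult_add_left sum.distrib by simp
  also have "\<dots> = (\<Sum>k\<le>Suc (Suc n).
      smult (?c (Suc (Suc n)) k + q ^ n * (1 - q ^ Suc n) * ?c n k) (?\<phi> k))"
    unfolding sum.atMost_Suc_shift[of _ "Suc n"]
    by (simp only: qHermite_coeff_recurrence_Suc[of n] qHermite_coeff_recurrence_0[of n])
  also have "\<dots> = qHermite q (int (Suc (Suc n)))
      + smult (q ^ n * (1 - q ^ Suc n)) (qHermite q (int n))"
    unfolding qHermite_newton_upto[of "Suc (Suc n)" "Suc (Suc n)", OF order.refl]
      qHermite_newton_upto[of n "Suc (Suc n)", OF le_SucI[OF le_SucI[OF order.refl]]]
    by (simp only: smult_add_left sum.distrib smult_sum_distrib smult_smult)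
  finally show ?thesis .
qed

text \<open>
  Dilating \<open>x\<close> to \<open>q x\<close> shifts the nodes \<open>1, q, \<dots>, q\<^sup>k\<close> by one, so that all but one factor is shared
  between the two terms of the difference quotient.
\<close>

lemma qdiff_poly_qnewton: "qdiff_poly q (qnewton q (Suc k)) = smult (qnum q (int (Suc k))) (qnewton q k)"
proof (rule qdiff_poly_unique[OF q_neq1])
  have "poly ([:0, q - 1:] * smult (qnum q (int (Suc k))) (qnewton q k)) x
      = poly (pcompose (qnewton q (Suc k)) [:0, q:] - qnewton q (Suc k)) x" for x
  proof -
    have "(\<Prod>i<Suc k. q * x - q ^ i) = (q * x - 1) * (\<Prod>i<k. q * x - q ^ Suc i)"
      by (subst prod.lessThan_Suc_shift) simp
    also have "(\<Prod>i<k. q * x - q ^ Suc i) = q ^ k * (\<Prod>i<k. x - q ^ i)"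
      by (simp add: right_diff_distrib[symmetric] prod.distrib)
    finally have "(\<Prod>i<Suc k. q * x - q ^ i) - (\<Prod>i<Suc k. x - q ^ i)
        = (q ^ Suc k - 1) * x * (\<Prod>i<k. x - q ^ i)"
      by (simp add: algebra_simps)
    moreover have "(q - 1) * qnum q (int (Suc k)) = q ^ Suc k - 1"
      using q_less unfolding qnum_of_nat by (simp add: field_simps)
    moreover have "poly ([:0, q - 1:] * smult (qnum q (int (Suc k))) (qnewton q k)) x
        = (q - 1) * qnum q (int (Suc k)) * x * (\<Prod>i<k. x - q ^ i)"
      by (simp add: poly_qnewton)
    moreover have "poly (pcompose (qnewton q (Suc k)) [:0, q:] - qnewton q (Suc k)) x
        = (\<Prod>i<Suc k. q * x - q ^ i) - (\<Prod>i<Suc k. x - q ^ i)"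
      by (simp add: poly_pcompose poly_qnewton mult.commute)
    ultimately show ?thesis by simp
  qed
  then show "[:0, q - 1:] * smult (qnum q (int (Suc k))) (qnewton q k)
      = pcompose (qnewton q (Suc k)) [:0, q:] - qnewton q (Suc k)"
    using poly_eq_poly_eq_iff by blast
qed

text \<open>
  The \<open>q\<close>-derivative lowers the Newton basis, and the coefficients satisfy the matching relation, so
  that \<open>H\<^sub>n\<close> behaves like a power: \<open>D\<^sub>q H\<^sub>n = [n]\<^sub>q H\<^sub>n\<^sub>-\<^sub>1\<close>.
\<close>

theorem qdiff_poly_qHermite_Suc:
  "qdiff_poly q (qHermite q (int (Suc n))) = smult (qnum q (int (Suc n))) (qHermite q (int n))"
proof -
  let ?c = "\<lambda>m k. qHermite_coeff q m k" and ?\<phi> = "qnewton q"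
  have c: "?c (Suc n) (Suc k) * qnum q (int (Suc k)) = qnum q (int (Suc n)) * ?c n k" for k
    using qHermite_coeff_lower[of k n] unfolding qnum_of_nat by (simp add: field_simps)
  have "qdiff_poly q (qHermite q (int (Suc n)))
      = (\<Sum>k\<le>Suc n. smult (?c (Suc n) k) (qdiff_poly q (?\<phi> k)))"
    unfolding qHermite_newton
    by (simp only: qdiff_poly_sum[OF q_neq1] qdiff_poly_smult[OF q_neq1])
  also have "\<dots> = (\<Sum>k\<le>n. smult (?c (Suc n) (Suc k)) (qdiff_poly q (?\<phi> (Suc k))))"
    using qdiff_poly_const[OF q_neq1, of 1]
    by (simp add: sum.atMost_Suc_shift qnewton_def[of q 0] one_pCons del: sum.atMost_Suc)
  also have "\<dots> = smult (qnum q (int (Suc n))) (qHermite q (int n))"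
    unfolding qdiff_poly_qnewton qHermite_newton smult_sum_distrib smult_smult c ..
  finally show ?thesis .
qed

lemma qHermite_0: "qHermite q 0 = 1"
  by (simp add: qHermite_def qpoch_def numeral_2_eq_2)

lemma qHermite_1: "qHermite q 1 = [:0, 1:]"
proof -
  have "(1 - inverse q) * q / (1 - q) = - 1" using q_less q_pos by (simp add: field_simps)
  then show ?thesis
    by (simp add: qHermite_def qpoch_def atMost_Suc power_int_minus numeral_2_eq_2 one_pCons)
qed

lemma qHermite_degree_monic:
  "degree (qHermite q (int n)) = n \<and> lead_coeff (qHermite q (int n)) = 1"
proof (induction n rule: less_induct)
  case (less n)
  show ?case
  proof (cases n)
    case 0
    then show ?thesis by (simp add: qHermite_0)
  next
    case (Suc m)
    show ?thesis
    proof (cases m)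
      case 0
      then show ?thesis using Suc by (simp add: qHermite_1)
    next
      case (Suc k)
      have n: "n = Suc (Suc k)" using Suc \<open>n = Suc m\<close> by simp
      let ?p = "[:0, 1:] * qHermite q (int (Suc k))"
      let ?r = "smult (q ^ k * (1 - q ^ Suc k)) (qHermite q (int k))"
      have IH: "degree (qHermite q (int k)) = k" "degree (qHermite q (int (Suc k))) = Suc k"
        "lead_coeff (qHermite q (int (Suc k))) = 1"
        using less[of k] less[of "Suc k"] n by auto
      have nz: "qHermite q (int (Suc k)) \<noteq> 0" using IH(3) by auto
      have eq: "qHermite q (int n) = ?p - ?r" using qHermite_three_term[of k] by (simp add: n)
      have dp: "degree ?p = Suc (Suc k)" "lead_coeff ?p = 1"
        using IH nz by (simp_all add: degree_mult_eq lead_coeff_mult del: of_nat_Suc)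
      have dr: "degree ?r < Suc (Suc k)" using IH(1) by (simp add: le_less_trans[OF degree_smult_le])
      have "degree (qHermite q (int n)) = Suc (Suc k)"
        unfolding eq using degree_add_eq_left[of "- ?r" ?p] dp dr by simp
      moreover have "coeff (qHermite q (int n)) (Suc (Suc k)) = 1"
        using dp(2) unfolding dp(1) eq coeff_diff coeff_eq_0[OF dr] by (simp only: diff_zero)
      ultimately show ?thesis by (simp add: n)
    qed
  qed
qed

end

section \<open>Orthogonality under the Jackson integral\<close>

text \<open>
  The weight at both nodes \<open>q\<^sup>m\<close> and \<open>- q\<^sup>m\<close>; it is even, hence one function of \<open>m\<close> suffices.
\<close>

definition qweight :: "real \<Rightarrow> nat \<Rightarrow> real" where
  "qweight q m = qpoch_inf (q * q ^ m) q * qpoch_inf (- (q * q ^ m)) q"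

text \<open>
  On polynomials the Jackson integral against the weight is an ordinary linear functional, and all
  orthogonality arguments below use only its algebra.
\<close>

definition jackson_functional :: "real \<Rightarrow> real poly \<Rightarrow> real" where
  "jackson_functional q p =
     jackson_integral q (\<lambda>x. poly p x * (qpoch_inf (q * x) q * qpoch_inf (- (q * x)) q))"

context q_base
begin

lemma mult_qpow_less_1:
  assumes "a < 1"
  shows "a * q ^ i < 1"
proof (cases "a \<le> 0")
  case True
  then have "a * q ^ i \<le> 0" using q_pos by (simp add: mult_le_0_iff)
  then show ?thesis by simp
next
  case False
  then have "a * q ^ i \<le> a * 1" using q_pos q_less by (intro mult_left_mono power_le_one) auto
  then show ?thesis using assms by simp
qed

lemma convergent_prod_qpoch:
  assumes "a < 1"
  shows "convergent_prod (\<lambda>i. 1 - a * q ^ i)"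
proof -
  have "summable (\<lambda>i. \<bar>- a * q ^ i\<bar>)"
    using q_pos q_less by (simp add: abs_mult summable_mult summable_geometric)
  moreover have "- a * q ^ i \<noteq> - 1" for i using mult_qpow_less_1[OF assms, of i] by simp
  ultimately have "convergent_prod (\<lambda>i. 1 + (- a * q ^ i))"
    by (rule summable_imp_convergent_prod_real)
  then show ?thesis by simp
qed

lemma qpoch_tendsto_qpoch_inf:
  assumes "a < 1"
  shows "(\<lambda>n. qpoch a q n) \<longlonglongrightarrow> qpoch_inf a q"
  using convergent_prod_LIMSEQ[OF convergent_prod_qpoch[OF assms]]
  unfolding qpoch_def qpoch_inf_def LIMSEQ_lessThan_iff_atMost .

lemma qpoch_inf_pos:
  assumes "a < 1"
  shows "qpoch_inf a q > 0"
  unfolding qpoch_inf_def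
  using convergent_prod_qpoch[OF assms] mult_qpow_less_1[OF assms] by (intro less_0_prodinf) auto

lemma qpoch_inf_head:
  assumes "a < 1"
  shows "qpoch_inf a q = (1 - a) * qpoch_inf (a * q) q"
proof (rule LIMSEQ_unique)
  show "(\<lambda>n. qpoch a q (Suc n)) \<longlonglongrightarrow> qpoch_inf a q"
    using qpoch_tendsto_qpoch_inf[OF assms] by (rule LIMSEQ_Suc)
  have "qpoch a q (Suc n) = (1 - a) * qpoch (a * q) q n" for n
    unfolding qpoch_def prod.lessThan_Suc_shift by (simp add: mult_ac)
  moreover have "a * q < 1" using mult_qpow_less_1[OF assms, of 1] by simp
  ultimately show "(\<lambda>n. qpoch a q (Suc n)) \<longlonglongrightarrow> (1 - a) * qpoch_inf (a * q) q"
    by (simp add: qpoch_tendsto_qpoch_inf tendsto_mult_left)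
qed

lemma qweight_pos: "qweight q m > 0"
  unfolding qweight_def using q_pos qpow_less_1[of m]
  by (intro mult_pos_pos qpoch_inf_pos) (auto intro: less_trans[of _ 0] simp: mult_pos_pos)

text \<open>
  The Pearson equation \<open>(1 - x\<^sup>2) w(x) = w(x / q)\<close> of the weight, at the node \<open>x = q\<^sup>m\<^sup>+\<^sup>1\<close>.
\<close>

lemma qweight_Suc: "(1 - q ^ (2 * Suc m)) * qweight q (Suc m) = qweight q m"
proof -
  have lt: "q * q ^ m < 1" "- (q * q ^ m) < 1"
    using q_pos qpow_less_1[of m] by (auto intro: less_trans[of _ 0])
  have 1: "qweight q (Suc m) = qpoch_inf (q * q ^ m * q) q * qpoch_inf (- (q * q ^ m) * q) q"
    by (simp add: qweight_def mult_ac)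
  have 2: "1 - q ^ (2 * Suc m) = (1 - q * q ^ m) * (1 - - (q * q ^ m))"
    by (simp add: power_mult power2_eq_square algebra_simps power_even_eq)
  show ?thesis
    unfolding 1 2 unfolding qweight_def qpoch_inf_head[OF lt(1)] qpoch_inf_head[OF lt(2)] by algebra
qed

lemma qweight_bounded: "\<exists>C. \<forall>m. qweight q m \<le> C"
proof -
  have "qweight q m \<le> 1 * qpoch_inf (-1) q" for m
  proof -
    define a where "a = q * q ^ m"
    have a: "0 < a" "a < 1" using q_pos qpow_less_1[of m] by (auto simp: a_def)
    have "qpoch a q n \<le> 1" for n
      unfolding qpoch_def
      using a mult_qpow_less_1[OF a(2)] q_pos by (intro prod_le_1) (auto simp: less_imp_le)
    then have 1: "qpoch_inf a q \<le> 1"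
      using qpoch_tendsto_qpoch_inf[OF a(2)] by (intro LIMSEQ_le_const2) auto
    have "qpoch (- a) q n \<le> qpoch (-1) q n" for n
      unfolding qpoch_def using a q_pos by (intro prod_mono) (auto intro: add_nonneg_nonneg)
    then have 2: "qpoch_inf (- a) q \<le> qpoch_inf (-1) q"
      using a by (intro LIMSEQ_le[OF qpoch_tendsto_qpoch_inf qpoch_tendsto_qpoch_inf]) auto
    show ?thesis
      unfolding qweight_def a_def[symmetric]
      using 1 2 a qpoch_inf_pos[of "- a"] by (intro mult_mono) auto
  qed
  then show ?thesis by blast
qed

lemma jackson_functional_eq:
  "jackson_functional q p = (1 - q) * (\<Sum>m. q ^ m * (qweight q m * (poly p (q ^ m) + poly p (- (q ^ m)))))"
  unfolding jackson_functional_def jackson_integral_def qweight_def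
  by (simp add: algebra_simps)

lemma jackson_summable:
  "summable (\<lambda>m. q ^ m * (qweight q m * (poly p (q ^ m) + poly p (- (q ^ m)))))"
proof -
  have "compact (poly p ` {-1..1})"
    by (intro compact_continuous_image continuous_intros) auto
  then have "bounded (poly p ` {-1..1})" by (rule compact_imp_bounded)
  then obtain B where "\<forall>y\<in>poly p ` {-1..1}. norm y \<le> B" unfolding bounded_iff by blast
  then have B: "\<And>x. x \<in> {-1..1} \<Longrightarrow> \<bar>poly p x\<bar> \<le> B" by simp
  obtain C where C: "\<And>m. qweight q m \<le> C" using qweight_bounded by blast
  have q1: "q ^ m \<in> {-1..1}" "- (q ^ m) \<in> {-1..1}" for m
  proof -
    have "0 \<le> q ^ m" "q ^ m \<le> 1" using power_le_one[of q m] q_pos q_less by auto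
    then show "q ^ m \<in> {-1..1}" "- (q ^ m) \<in> {-1..1}" unfolding atLeastAtMost_iff by linarith+
  qed
  show ?thesis
  proof (rule summable_comparison_test)
    show "summable (\<lambda>m. q ^ m * (C * (B + B)))"
      using q_pos q_less by (intro summable_mult2 summable_geometric) auto
    show "\<exists>N. \<forall>m\<ge>N. norm (q ^ m * (qweight q m * (poly p (q ^ m) + poly p (- (q ^ m))))) \<le> q ^ m * (C * (B + B))"
    proof (intro exI allI impI)
      fix m
      have "\<bar>poly p (q ^ m) + poly p (- (q ^ m))\<bar> \<le> B + B"
        using B[OF q1(1)[of m]] B[OF q1(2)[of m]] by linarith
      then have "\<bar>qweight q m\<bar> * \<bar>poly p (q ^ m) + poly p (- (q ^ m))\<bar> \<le> C * (B + B)"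
        using qweight_pos[of m] C[of m] by (intro mult_mono) auto
      then show "norm (q ^ m * (qweight q m * (poly p (q ^ m) + poly p (- (q ^ m))))) \<le> q ^ m * (C * (B + B))"
        using q_pos by (simp add: abs_mult mult_left_mono)
    qed
  qed
qed

lemma jackson_functional_add:
  "jackson_functional q (p + r) = jackson_functional q p + jackson_functional q r"
  using suminf_add[OF jackson_summable[of p] jackson_summable[of r]]
  unfolding jackson_functional_eq distrib_left[symmetric]
  by (simp only: poly_add add_ac distrib_left[symmetric])

lemma jackson_functional_smult:
  "jackson_functional q (smult c p) = c * jackson_functional q p"
  using suminf_mult[OF jackson_summable[of p], of c]
  unfolding jackson_functional_eq by (simp add: distrib_left[symmetric] mult_ac)

lemma jackson_functional_diff:
  "jackson_functional q (p - r) = jackson_functional q p - jackson_functional q r"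
  using jackson_functional_add[of "p - r" r] by simp

lemma jackson_functional_sum:
  "jackson_functional q (\<Sum>i\<in>I. f i) = (\<Sum>i\<in>I. jackson_functional q (f i))"
  using jackson_functional_smult[of 0 0]
  by (induction I rule: infinite_finite_induct) (simp_all add: jackson_functional_add)

text \<open>
  Integration by parts.  By the Pearson equation the integrand of
  \<open>x p - (1 - q) D\<^sub>q p\<close> is a \<open>q\<close>-difference of \<open>p(x) w(x / q)\<close>, so the series telescopes; the boundary
  term at \<open>x = \<plusminus>1\<close> vanishes with \<open>1 - x\<^sup>2\<close> and those at the origin cancel each other.
\<close>

lemma jackson_functional_X:
  "jackson_functional q ([:0, 1:] * p) = (1 - q) * jackson_functional q (qdiff_poly q p)"
proof -
  let ?r = "[:0, 1:] * p - smult (1 - q) (qdiff_poly q p)"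
  define d where "d m = poly p (q ^ m) - poly p (- (q ^ m))" for m
  define G where "G m = (1 - q ^ (2 * m)) * qweight q m * d m" for m
  \<comment> \<open>The difference structure of the integrand; \<open>G m\<close> is the difference of the values of \<open>p(x) w(x / q)\<close> at \<open>x = q\<^sup>m\<close> and \<open>x = - q\<^sup>m\<close>.\<close>
  have tm: "q ^ m * (qweight q m * (poly ?r (q ^ m) + poly ?r (- (q ^ m)))) = - (G m - G (Suc m))" for m
  proof -
    have G_Suc: "G (Suc m) = qweight q m * d (Suc m)" unfolding G_def qweight_Suc ..
    have "(q - 1) * q ^ m * poly (qdiff_poly q p) (q ^ m) = poly p (q ^ Suc m) - poly p (q ^ m)"
      "(q - 1) * - (q ^ m) * poly (qdiff_poly q p) (- (q ^ m)) = poly p (- (q ^ Suc m)) - poly p (- (q ^ m))"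
      using poly_qdiff_poly[OF q_neq1, of "q ^ m" p] poly_qdiff_poly[OF q_neq1, of "- (q ^ m)" p] by auto
    then have "(q - 1) * q ^ m * (poly (qdiff_poly q p) (q ^ m) + poly (qdiff_poly q p) (- (q ^ m)))
        = d (Suc m) - d m"
      unfolding d_def by (simp add: algebra_simps)
    moreover have "q ^ m * (poly ?r (q ^ m) + poly ?r (- (q ^ m)))
        = q ^ (2 * m) * d m + (q - 1) * q ^ m * (poly (qdiff_poly q p) (q ^ m) + poly (qdiff_poly q p) (- (q ^ m)))"
      unfolding d_def mult_2 power_add by (simp add: algebra_simps)
    ultimately have "q ^ m * (poly ?r (q ^ m) + poly ?r (- (q ^ m))) = q ^ (2 * m) * d m + (d (Suc m) - d m)"
      by simp
    then have "qweight q m * (q ^ m * (poly ?r (q ^ m) + poly ?r (- (q ^ m))))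
        = qweight q m * (q ^ (2 * m) * d m + (d (Suc m) - d m))" by simp
    then show ?thesis unfolding G_Suc unfolding G_def by (simp only: algebra_simps)
  qed
  \<comment> \<open>The two points \<open>q\<^sup>m\<close>, \<open>- q\<^sup>m\<close> approach each other, so \<open>d m\<close> tends to \<open>0\<close> while the weight stays bounded.\<close>
  have "G \<longlonglongrightarrow> 0"
  proof -
    obtain C where C: "\<And>m. qweight q m \<le> C" using qweight_bounded by blast
    have q0: "(\<lambda>m. q ^ m) \<longlonglongrightarrow> 0" using q_pos q_less by (intro LIMSEQ_realpow_zero) auto
    have p0: "(\<lambda>m. poly p (f m)) \<longlonglongrightarrow> poly p 0" if "f \<longlonglongrightarrow> 0" for f
      using that isCont_tendsto_compose[OF poly_isCont] by blast
    have "d \<longlonglongrightarrow> poly p 0 - poly p 0"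
      unfolding d_def using q0 tendsto_minus[OF q0] by (intro tendsto_diff p0) auto
    then have lim: "(\<lambda>m. C * \<bar>d m\<bar>) \<longlonglongrightarrow> 0"
      by (auto intro: tendsto_mult_right_zero tendsto_rabs_zero)
    have bound: "norm (G m) \<le> C * \<bar>d m\<bar>" for m
    proof -
      have "0 \<le> 1 - q ^ (2 * m)" "1 - q ^ (2 * m) \<le> 1"
        using power_le_one[of q "2 * m"] q_pos q_less by auto
      then have "(1 - q ^ (2 * m)) * qweight q m \<le> 1 * C" "0 \<le> (1 - q ^ (2 * m)) * qweight q m"
        using qweight_pos[of m] C[of m] by (intro mult_mono mult_nonneg_nonneg; simp)+
      then show ?thesis unfolding G_def by (simp add: abs_mult mult_right_mono)
    qed
    then show ?thesis by (intro Lim_null_comparison[OF _ lim]) auto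
  qed
  then have "(\<lambda>m. - (G m - G (Suc m))) sums - (G 0 - 0)"
    by (intro sums_minus telescope_sums')
  then have "jackson_functional q ?r = 0"
    unfolding jackson_functional_eq tm by (simp add: sums_iff G_def)
  then show ?thesis by (simp add: jackson_functional_diff jackson_functional_smult)
qed

text \<open>
  Splitting \<open>(q; q)\<^sub>2\<^sub>N\<close> into odd and even exponents.  In the limit this is Euler's identity
  \<open>(q; q\<^sup>2)\<^sub>\<infinity> (- q; q)\<^sub>\<infinity> = 1\<close>.
\<close>

lemma qpoch_split_even_odd: "qpoch q (q\<^sup>2) N * qpoch q q N * qpoch (- q) q N = qpoch q q (2 * N)"
proof (induction N)
  case 0
  then show ?case by (simp add: qpoch_def)
next
  case (Suc N)
  have step: "(1 - q * (q\<^sup>2) ^ N) * ((1 - q * q ^ N) * (1 - - q * q ^ N))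
      = (1 - q * q ^ (2 * N)) * (1 - q * q ^ Suc (2 * N))"
    by (simp add: power_mult power2_eq_square power_mult_distrib algebra_simps power_even_eq)
  have prod_eq: "(a * x) * (b * y) * (c * z) = d * u * v"
    if "a * b * c = d" "x * (y * z) = u * v" for a b c d u v x y z :: real
  proof -
    have "(a * x) * (b * y) * (c * z) = (a * b * c) * (x * (y * z))" by (simp only: mult_ac)
    also have "\<dots> = d * (u * v)" by (simp only: that)
    finally show ?thesis by (simp only: mult.assoc)
  qed
  show ?case
    using prod_eq[OF Suc.IH[unfolded qpoch_def] step]
    unfolding mult_Suc_right add_2_eq_Suc qpoch_def prod.lessThan_Suc by simp
qed

text \<open>
  The total mass of the weight.  The power series \<open>f(z) = \<Sum>m. w(q\<^sup>m) z\<^sup>m\<close> satisfies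
  \<open>(1 - z) f(z) = f(q\<^sup>2 z)\<close> by the Pearson equation.  Iterating from \<open>z = q\<close> moves the argument to
  \<open>0\<close>, where \<open>f\<close> is continuous with value \<open>w(1)\<close>, and produces the factor
  \<open>1 / (q; q\<^sup>2)\<^sub>\<infinity> = (- q; q)\<^sub>\<infinity>\<close>.
\<close>

lemma suminf_qweight: "(\<Sum>m. q ^ m * qweight q m) = qweight q 0 * qpoch_inf (- q) q"
proof -
  define f where "f z = (\<Sum>m. qweight q m * z ^ m)" for z
  obtain C where C: "\<And>m. qweight q m \<le> C" using qweight_bounded by blast
  have summable: "summable (\<lambda>m. qweight q m * z ^ m)" if "0 \<le> z" "z < 1" for z
  proof (rule summable_comparison_test)
    show "summable (\<lambda>m. C * z ^ m)" using that by (intro summable_mult summable_geometric) auto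
    show "\<exists>N. \<forall>m\<ge>N. norm (qweight q m * z ^ m) \<le> C * z ^ m"
      using that C qweight_pos by (auto simp: abs_mult less_imp_le intro!: mult_right_mono)
  qed
  have step: "(1 - z) * f z = f (q\<^sup>2 * z)" if z: "0 \<le> z" "z < 1" for z
  proof -
    have q2: "0 \<le> q\<^sup>2 * z" "q\<^sup>2 * z < 1"
    proof -
      have "q\<^sup>2 * z \<le> 1 * z" using q_pos q_less z by (intro mult_right_mono power_le_one) auto
      then show "0 \<le> q\<^sup>2 * z" "q\<^sup>2 * z < 1" using z by auto
    qed
    have q2m: "(q\<^sup>2 * z) ^ m = q ^ (2 * m) * z ^ m" for m by (simp add: power_mult_distrib power_mult)
    have tm: "qweight q m * z ^ m - qweight q m * (q\<^sup>2 * z) ^ m = (1 - q ^ (2 * m)) * qweight q m * z ^ m" for m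
      unfolding q2m by (simp add: algebra_simps)
    have "f z - f (q\<^sup>2 * z) = (\<Sum>m. qweight q m * z ^ m - qweight q m * (q\<^sup>2 * z) ^ m)"
      unfolding f_def by (rule suminf_diff[OF summable[OF z] summable[OF q2]])
    also have "\<dots> = (\<Sum>m. (1 - q ^ (2 * m)) * qweight q m * z ^ m)"
      by (simp only: tm)
    also have "\<dots> = (\<Sum>m. (1 - q ^ (2 * Suc m)) * qweight q (Suc m) * z ^ Suc m)"
    proof -
      have "summable (\<lambda>m. (1 - q ^ (2 * m)) * qweight q m * z ^ m)"
        using summable_diff[OF summable[OF z] summable[OF q2]]
        by (simp only: tm)
      from suminf_split_head[OF this] show ?thesis by simp
    qed
    also have "\<dots> = z * f z"
      unfolding qweight_Suc f_def suminf_mult[OF summable[OF z], symmetric] by (simp add: mult_ac)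
    finally show ?thesis by (simp add: algebra_simps)
  qed
  have iter: "qpoch q (q\<^sup>2) N * f q = f (q ^ Suc (2 * N))" for N
  proof (induction N)
    case 0
    then show ?case by (simp add: qpoch_def)
  next
    case (Suc N)
    have "qpoch q (q\<^sup>2) (Suc N) * f q = (1 - q * (q\<^sup>2) ^ N) * (qpoch q (q\<^sup>2) N * f q)"
      by (simp add: qpoch_def)
    also have "\<dots> = (1 - q ^ Suc (2 * N)) * f (q ^ Suc (2 * N))"
      unfolding Suc by (simp add: power_mult)
    also have "\<dots> = f (q\<^sup>2 * q ^ Suc (2 * N))"
      using qpow_less_1[of "2 * N"] q_pos by (intro step) auto
    finally show ?case by (simp add: power2_eq_square mult.assoc)
  qed
  have "isCont f 0"
    unfolding f_def[abs_def] using summable[of q] q_pos q_less by (intro isCont_powser[of _ q]) auto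
  moreover have "(\<lambda>N. q ^ Suc (2 * N)) \<longlonglongrightarrow> 0"
    using LIMSEQ_subseq_LIMSEQ[OF LIMSEQ_realpow_zero[of q], of "\<lambda>N. Suc (2 * N)"] q_pos q_less
    by (simp add: strict_mono_def o_def)
  ultimately have fN: "(\<lambda>N. f (q ^ Suc (2 * N))) \<longlonglongrightarrow> f 0"
    by (rule isCont_tendsto_compose)
  have f0: "f 0 = qweight q 0" unfolding f_def by (simp add: powser_zero)
  have lims: "(\<lambda>N. qpoch q q N) \<longlonglongrightarrow> qpoch_inf q q" "(\<lambda>N. qpoch (- q) q N) \<longlonglongrightarrow> qpoch_inf (- q) q"
    using q_pos q_less by (auto intro!: qpoch_tendsto_qpoch_inf)
  have lim2: "(\<lambda>N. qpoch q q (2 * N)) \<longlonglongrightarrow> qpoch_inf q q"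
    using LIMSEQ_subseq_LIMSEQ[OF lims(1), of "\<lambda>N. 2 * N"] by (simp add: strict_mono_def o_def)
  have "qpoch q q (2 * N) * f q = f (q ^ Suc (2 * N)) * (qpoch q q N * qpoch (- q) q N)" for N
    unfolding qpoch_split_even_odd[symmetric] iter[symmetric] by (simp only: mult_ac)
  moreover have "(\<lambda>N. qpoch q q (2 * N) * f q) \<longlonglongrightarrow> qpoch_inf q q * f q"
    by (intro tendsto_intros lim2)
  moreover have "(\<lambda>N. f (q ^ Suc (2 * N)) * (qpoch q q N * qpoch (- q) q N))
      \<longlonglongrightarrow> f 0 * (qpoch_inf q q * qpoch_inf (- q) q)"
    by (intro tendsto_mult fN lims)
  ultimately have "qpoch_inf q q * f q = f 0 * (qpoch_inf q q * qpoch_inf (- q) q)"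
    by (simp add: LIMSEQ_unique)
  then have "f q = qweight q 0 * qpoch_inf (- q) q"
    using qpoch_inf_pos[OF q_less] by (simp add: f0)
  then show ?thesis by (simp add: f_def mult.commute)
qed

lemma jackson_functional_1: "jackson_functional q 1 = qH_norm2 q 0"
proof -
  have "jackson_functional q 1 = (1 - q) * (\<Sum>m. 2 * (q ^ m * qweight q m))"
    unfolding jackson_functional_eq by (simp add: mult_ac)
  also have "\<dots> = (1 - q) * (2 * (qweight q 0 * qpoch_inf (- q) q))"
  proof -
    have "summable (\<lambda>m. q ^ m * qweight q m)"
      using summable_mult[OF jackson_summable[of 1], of "1 / 2"] by (simp add: mult_ac)
    from suminf_mult[OF this, of 2] show ?thesis unfolding suminf_qweight by simp
  qed
  also have "\<dots> = qH_norm2 q 0"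
    using qpoch_inf_head[of "- 1"] by (simp add: qweight_def qH_norm2_def qpoch_def numeral_2_eq_2)
  finally show ?thesis .
qed

lemma qH_norm2_pos: "qH_norm2 q (int n) > 0"
  unfolding qH_norm2_def
  using q_pos q_less qpoch_q_pos[of n] by (simp add: qpoch_inf_pos)

lemma qH_norm2_Suc: "qH_norm2 q (int (Suc n)) = q ^ n * (1 - q ^ Suc n) * qH_norm2 q (int n)"
  unfolding qH_norm2_def
  by (simp add: qpoch_Suc choose2_Suc power_add del: of_nat_Suc)

text \<open>
  The recurrence expresses \<open>H\<^sub>n\<^sub>+\<^sub>1\<close> through \<open>x H\<^sub>n\<close> and \<open>H\<^sub>n\<^sub>-\<^sub>1\<close>; integration by parts turns
  \<open>x H\<^sub>n\<close> into \<open>(1 - q) [n]\<^sub>q H\<^sub>n\<^sub>-\<^sub>1\<close>.  The resulting factor of the mean of \<open>H\<^sub>n\<^sub>-\<^sub>1\<close> is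
  \<open>(1 - q\<^sup>n) (1 - q\<^sup>n\<^sup>-\<^sup>1)\<close>, which vanishes exactly when \<open>H\<^sub>n\<^sub>-\<^sub>1\<close> is the constant polynomial.
\<close>

lemma jackson_functional_qHermite: "jackson_functional q (qHermite q (int (Suc n))) = 0"
proof (induction n rule: less_induct)
  case (less n)
  show ?case
  proof (cases n)
    case 0
    have "jackson_functional q ([:0, 1:] * 1) = 0"
      using jackson_functional_smult[of 0 0] q_less
      unfolding jackson_functional_X by (simp add: one_pCons qdiff_poly_const)
    then show ?thesis using 0 qHermite_1 by simp
  next
    case (Suc m)
    have "qHermite q (int (Suc n)) = [:0, 1:] * qHermite q (int (Suc m))
        - smult (q ^ m * (1 - q ^ Suc m)) (qHermite q (int m))"
      using qHermite_three_term[of m] Suc by simp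
    then have "jackson_functional q (qHermite q (int (Suc n)))
        = ((1 - q) * qnum q (int (Suc m)) - q ^ m * (1 - q ^ Suc m)) * jackson_functional q (qHermite q (int m))"
      by (simp only: jackson_functional_diff jackson_functional_X jackson_functional_smult
          qdiff_poly_qHermite_Suc left_diff_distrib mult.assoc)
    moreover have "jackson_functional q (qHermite q (int m)) = 0 \<or> m = 0"
      using less[of "m - 1"] Suc by (cases m) auto
    moreover have "(1 - q) * qnum q (int (Suc 0)) - q ^ 0 * (1 - q ^ Suc 0) = 0"
      using q_less by (simp add: qnum_def)
    ultimately show ?thesis by auto
  qed
qed

text \<open>
  Once all means vanish, the three-term recurrence gives orthogonality to every lower power: each
  factor \<open>x\<close> moves the index by at most one, and \<open>k < n\<close> factors never reach \<open>H\<^sub>0\<close>.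
\<close>

lemma jackson_functional_monom_qHermite:
  "k < n \<Longrightarrow> jackson_functional q (monom 1 k * qHermite q (int n)) = 0"
proof (induction k arbitrary: n)
  case 0
  then show ?case using jackson_functional_qHermite[of "n - 1"] by (simp add: monom_0)
next
  case (Suc k)
  then obtain m where n: "n = Suc m" by (cases n) auto
  have "monom 1 (Suc k) * qHermite q (int n) = monom 1 k * ([:0, 1:] * qHermite q (int (Suc m)))"
    unfolding n by (simp add: monom_Suc)
  also have "\<dots> = monom 1 k * qHermite q (int (Suc (Suc m)))
      + smult (q ^ m * (1 - q ^ Suc m)) (monom 1 k * qHermite q (int m))"
    unfolding qHermite_three_term by (simp add: algebra_simps)
  finally show ?case
    using Suc.IH[of "Suc (Suc m)"] Suc.IH[of m] Suc.prems n
    by (simp only: jackson_functional_add jackson_functional_smult)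
qed

theorem jackson_functional_qHermite_orth:
  assumes "degree p < n"
  shows "jackson_functional q (p * qHermite q (int n)) = 0"
proof -
  have "p * qHermite q (int n)
      = (\<Sum>i\<le>degree p. smult (coeff p i) (monom 1 i * qHermite q (int n)))"
    by (subst poly_as_sum_of_monoms[of p, symmetric])
       (simp add: sum_distrib_right smult_monom flip: mult_smult_left)
  then show ?thesis
    using assms by (simp add: jackson_functional_sum jackson_functional_smult jackson_functional_monom_qHermite)
qed

lemma qHermite_orthogonal:
  assumes "m \<noteq> n"
  shows "jackson_functional q (qHermite q (int m) * qHermite q (int n)) = 0"
  using assms jackson_functional_qHermite_orth[of "qHermite q (int m)" n]
    jackson_functional_qHermite_orth[of "qHermite q (int n)" m]
    qHermite_degree_monic
  by (cases "m < n") (auto simp: mult.commute)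

text \<open>
  The squared norm is multiplied by \<open>\<gamma>\<^sub>n\<^sub>+\<^sub>1\<close> in each step, because the two factors
  \<open>x\<close> and \<open>H\<^sub>n\<^sub>+\<^sub>1\<close> of \<open>x H\<^sub>n H\<^sub>n\<^sub>+\<^sub>1\<close> can be combined by the recurrence into
  \<open>H\<^sub>n H\<^sub>n\<^sub>+\<^sub>2 + \<gamma>\<^sub>n\<^sub>+\<^sub>1 H\<^sub>n\<^sup>2\<close>, whose first term has integral \<open>0\<close>.
\<close>

theorem qHermite_norm:
  "jackson_functional q (qHermite q (int n) * qHermite q (int n)) = qH_norm2 q (int n)"
proof (induction n)
  case 0
  then show ?case by (simp add: qHermite_0 jackson_functional_1)
next
  case (Suc n)
  let ?H = "\<lambda>n. qHermite q (int n)" and ?L = "jackson_functional q"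
  let ?g = "\<lambda>n. q ^ n * (1 - q ^ Suc n)"
  \<comment> \<open>Replace one factor \<open>H\<^sub>n\<^sub>+\<^sub>1\<close> by \<open>x H\<^sub>n\<close>, which differs from it by a multiple of \<open>H\<^sub>n\<^sub>-\<^sub>1\<close>.\<close>
  have "?L (?H (Suc n) * ?H (Suc n)) = ?L (?H n * ([:0, 1:] * ?H (Suc n)))"
  proof (cases n)
    case 0
    then show ?thesis
      using qHermite_0 qHermite_1 by simp
  next
    case (Suc m)
    have "?H (Suc n) * ?H (Suc n) = ?H n * ([:0, 1:] * ?H (Suc n)) - smult (?g m) (?H m * ?H (Suc n))"
    proof -
      have "?H (Suc n) = [:0, 1:] * ?H n - smult (?g m) (?H m)"
        using qHermite_three_term[of m] Suc by simp
      then have "?H (Suc n) * ?H (Suc n) = ([:0, 1:] * ?H n - smult (?g m) (?H m)) * ?H (Suc n)"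
        by (rule arg_cong)
      then show ?thesis
        by (simp only: left_diff_distrib mult_smult_left mult.left_commute[of "[:0, 1:]"] mult.assoc)
    qed
    then show ?thesis
      using qHermite_orthogonal[of m "Suc n"] Suc
      by (simp only: jackson_functional_diff jackson_functional_smult)
  qed
  also have "\<dots> = ?L (?H n * ?H (Suc (Suc n))) + ?g n * ?L (?H n * ?H n)"
    unfolding qHermite_three_term distrib_left mult_smult_right
      jackson_functional_add jackson_functional_smult ..
  also have "\<dots> = qH_norm2 q (int (Suc n))"
    unfolding Suc qH_norm2_Suc using qHermite_orthogonal[of n "Suc (Suc n)"] by simp
  finally show ?case .
qed

end

section \<open>The Sobolev-type polynomials as kernel perturbations\<close>

text \<open>
  Division by the leading terms, one degree at a time.  The hypothesis on coefficients rather than on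
  the degree covers the zero polynomial and \<open>n = 0\<close>.
\<close>

lemma monic_basis:
  fixes P :: "nat \<Rightarrow> real poly"
  assumes "\<And>n. degree (P n) = n" "\<And>n. lead_coeff (P n) = 1" "\<And>i. i \<ge> n \<Longrightarrow> coeff p i = 0"
  shows "\<exists>a. p = (\<Sum>k<n. smult (a k) (P k))"
  using assms(3)
proof (induction n arbitrary: p)
  case 0
  then have "p = 0" by (simp add: poly_eq_iff)
  then show ?case by simp
next
  case (Suc n)
  have Pn: "coeff (P n) n = 1" "\<And>i. i > n \<Longrightarrow> coeff (P n) i = 0"
    using assms(1)[of n] assms(2)[of n] coeff_eq_0[of "P n"] by auto
  have "coeff (p - smult (coeff p n) (P n)) i = 0" if "i \<ge> n" for i
    using that Suc.prems[of i] Pn by (cases "i = n") auto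
  from Suc.IH[OF this] obtain a where a: "p - smult (coeff p n) (P n) = (\<Sum>k<n. smult (a k) (P k))"
    by blast
  have "p = (\<Sum>k<Suc n. smult ((a(n := coeff p n)) k) (P k))"
    using a by (simp add: diff_eq_eq)
  then show ?case by blast
qed

text \<open>
  The kernel \<open>K\<^sub>n\<^sub>-\<^sub>1\<^sup>(\<^sup>0\<^sup>,\<^sup>j\<^sup>)(x, y)\<close> as a polynomial in \<open>x\<close>; the sum is empty for \<open>n = 0\<close>.
\<close>

definition qH_kernel_poly :: "real \<Rightarrow> nat \<Rightarrow> real \<Rightarrow> nat \<Rightarrow> real poly" where
  "qH_kernel_poly q j y n =
     (\<Sum>k<n. smult (poly ((qdiff_poly q ^^ j) (qHermite q (int k))) y / qH_norm2 q (int k))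
                  (qHermite q (int k)))"

context q_base
begin

lemma qdiff_poly_qHermite: "qdiff_poly q (qHermite q n) = smult (qnum q n) (qHermite q (n - 1))"
proof -
  consider "n < 0" | "n = 0" | m where "n = int (Suc m)"
    by (metis int_cases2 int_cases3 neg_0_less_iff_less not_less_iff_gr_or_eq of_nat_0
        of_nat_0_less_iff old.nat.exhaust)
  then show ?thesis
  proof cases
    case 1
    then show ?thesis
      using qdiff_poly_const[OF q_neq1, of 0] by (simp add: qHermite_def)
  next
    case 2
    then show ?thesis
      using qdiff_poly_const[OF q_neq1, of 1] by (simp add: qHermite_0 one_pCons qnum_def)
  next
    case (3 m)
    then show ?thesis using qdiff_poly_qHermite_Suc[of m] by simp
  qed
qed

text \<open>
  The product form \<open>[n]\<^sub>q [n - 1]\<^sub>q \<dots> [n - k + 1]\<^sub>q\<close> of the falling factorial.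
\<close>

lemma qfall_Suc: "qfall q n (Suc k) = qfall q n k * qnum q (n - int k)"
proof -
  have q0: "q \<noteq> 0" "q - 1 \<noteq> 0" "1 - q \<noteq> 0" using q_pos q_less by auto
  have e: "int (Suc k) * n - int (Suc k choose 2) = (int k * n - int (k choose 2)) + (n - int k)"
    by (simp add: choose2_Suc algebra_simps)
  have "(1 - q powi (- n) * q ^ k) * q powi (n - int k) = q powi (n - int k) - 1"
  proof -
    have "q powi (- n) * q ^ k * q powi (n - int k) = q powi (- n + int k + (n - int k))"
      unfolding power_int_add[OF disjI1[OF q0(1)]] by simp
    also have "\<dots> = 1" by simp
    finally show ?thesis by (simp add: left_diff_distrib)
  qed
  moreover have "qfall q n (Suc k) = qfall q n k * ((1 - q powi (- n) * q ^ k) * q powi (n - int k)) / (q - 1)"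
    unfolding qfall_def e qpoch_Suc power_int_add[OF disjI1[OF q0(1)]] power_Suc2
    by simp
  ultimately show ?thesis
    using q0 by (simp add: qnum_def field_simps)
qed

lemma qdiff_poly_iterate_qHermite:
  "(qdiff_poly q ^^ k) (qHermite q n) = smult (qfall q n k) (qHermite q (n - int k))"
proof (induction k)
  case 0
  then show ?case by (simp add: qfall_def qpoch_def numeral_2_eq_2)
next
  case (Suc k)
  then show ?case
    using q_less by (simp add: qdiff_poly_smult qdiff_poly_qHermite qfall_Suc algebra_simps)
qed

lemma sobolev_ip_poly:
  "sobolev_ip q \<alpha> lam j (poly f) (poly g) = jackson_functional q (f * g)
     + lam * poly ((qdiff_poly q ^^ j) f) \<alpha> * poly ((qdiff_poly q ^^ j) g) \<alpha>"
  using q_less by (simp add: sobolev_ip_def jackson_functional_def qderiv_iterate_poly)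

lemma sobolev_ip_smult_sum:
  "sobolev_ip q \<alpha> lam j (poly f) (poly (\<Sum>k\<in>I. smult (a k) (g k)))
     = (\<Sum>k\<in>I. a k * sobolev_ip q \<alpha> lam j (poly f) (poly (g k)))"
proof -
  show ?thesis
    unfolding sobolev_ip_poly
    by (simp add: sum_distrib_left sum.distrib distrib_left qdiff_poly_iterate_sum[OF q_neq1]
        qdiff_poly_iterate_smult[OF q_neq1] poly_sum jackson_functional_sum
        jackson_functional_smult mult_ac)
qed

lemma qH_kernel_eq:
  "qH_kernel q j j (int n - 1) \<alpha> \<alpha> = poly ((qdiff_poly q ^^ j) (qH_kernel_poly q j \<alpha> n)) \<alpha>"
proof -
  have "{0..int n - 1} = int ` {..<n}"
    by (force simp: image_iff intro: bexI[of _ "nat _"])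
  then have "qH_kernel q j j (int n - 1) \<alpha> \<alpha>
      = (\<Sum>k<n. (qderiv q ^^ j) (poly (qHermite q (int k))) \<alpha> *
          (qderiv q ^^ j) (poly (qHermite q (int k))) \<alpha> / qH_norm2 q (int k))"
    unfolding qH_kernel_def by (simp add: sum.reindex)
  then show ?thesis
    by (simp add: qH_kernel_poly_def qderiv_iterate_poly[OF q_neq1] qdiff_poly_iterate_sum[OF q_neq1]
        qdiff_poly_iterate_smult[OF q_neq1] poly_sum)
qed

text \<open>
  Expand \<open>P\<^sub>n - H\<^sub>n\<close>, of degree below \<open>n\<close>, in the Hermite basis.  Orthogonality of \<open>P\<^sub>n\<close> to \<open>H\<^sub>k\<close> for
  \<open>k < n\<close> in the Sobolev product says that the continuous part of the product equals
  \<open>- \<lambda> (D\<^sub>q\<^sup>j P\<^sub>n)(\<alpha>) (D\<^sub>q\<^sup>j H\<^sub>k)(\<alpha>)\<close>, so the correction is a multiple of the kernel.  The unknown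
  number \<open>(D\<^sub>q\<^sup>j P\<^sub>n)(\<alpha>)\<close> is found by applying \<open>D\<^sub>q\<^sup>j\<close> at \<open>\<alpha>\<close> to the result.
\<close>

theorem qH_Sobolev_connection:
  assumes lam: "lam > 0" and P: "qH_Sobolev_seq q \<alpha> lam j P"
  shows "P n = qHermite q (int n) - smult (qH_c q \<alpha> lam j (int n)) (qH_kernel_poly q j \<alpha> n)"
proof -
  let ?H = "\<lambda>k. qHermite q (int k)" and ?L = "jackson_functional q"
  let ?N = "\<lambda>k. qH_norm2 q (int k)"
  let ?E = "\<lambda>f. poly ((qdiff_poly q ^^ j) f) \<alpha>"
  let ?ip = "\<lambda>f g. sobolev_ip q \<alpha> lam j (poly f) (poly g)"
  let ?K = "qH_kernel_poly q j \<alpha> n"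
  have deg: "degree (P n) = n" "lead_coeff (P n) = 1" for n
    using P unfolding qH_Sobolev_seq_def by blast+
  have orth: "?ip (P m) (P n) = 0" if "m \<noteq> n" for m n
    using P that by (simp add: qH_Sobolev_seq_def)
  note Hdeg = qHermite_degree_monic
  have N: "?N k > 0" for k by (rule qH_norm2_pos)
  have orthH: "?L (P n * ?H k) = - lam * ?E (P n) * ?E (?H k)" if k: "k < n" for k
  proof -
    have "coeff (?H k) i = 0" if "i \<ge> Suc k" for i
      using that Hdeg[of k] by (intro coeff_eq_0) auto
    then obtain a where a: "?H k = (\<Sum>i<Suc k. smult (a i) (P i))"
      using monic_basis[OF deg, of "Suc k" "?H k"] by blast
    have "?ip (P n) (?H k) = (\<Sum>i<Suc k. a i * ?ip (P n) (P i))"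
      unfolding a by (rule sobolev_ip_smult_sum)
    also have "\<dots> = 0" using k by (intro sum.neutral) (auto simp: orth)
    finally show ?thesis by (simp add: sobolev_ip_poly)
  qed
  have "coeff (P n - ?H n) i = 0" if "i \<ge> n" for i
    using that deg[of n] Hdeg[of n] coeff_eq_0[of "P n" i] coeff_eq_0[of "?H n" i]
    by (cases "i = n") auto
  then obtain a where a: "P n - ?H n = (\<Sum>k<n. smult (a k) (?H k))"
    using monic_basis[of ?H n "P n - ?H n"] Hdeg by blast
  have a_eq: "a k = - lam * ?E (P n) * (?E (?H k) / ?N k)" if k: "k < n" for k
  proof -
    have "?L ((P n - ?H n) * ?H k) = (\<Sum>i<n. a i * ?L (?H i * ?H k))"
      unfolding a by (simp add: sum_distrib_right jackson_functional_sum
          jackson_functional_smult)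
    also have "\<dots> = (\<Sum>i<n. if i = k then a k * ?N k else 0)"
      by (intro sum.cong) (auto simp: qHermite_norm qHermite_orthogonal)
    also have "\<dots> = a k * ?N k" using k by simp
    finally have "?L (P n * ?H k) = a k * ?N k"
      using qHermite_orthogonal[of n k] k
      by (simp add: left_diff_distrib jackson_functional_diff)
    then show ?thesis using orthH[OF k] N[of k] by (simp add: field_simps)
  qed
  have Pn: "P n = ?H n - smult (lam * ?E (P n)) ?K"
  proof -
    have "P n - ?H n = (\<Sum>k<n. smult (- lam * ?E (P n)) (smult (?E (?H k) / ?N k) (?H k)))"
      unfolding a by (intro sum.cong) (auto simp: a_eq)
    also have "\<dots> = - smult (lam * ?E (P n)) ?K"
      unfolding qH_kernel_poly_def smult_sum_distrib[symmetric] by simp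
    finally show ?thesis by (simp add: diff_eq_eq)
  qed
  \<comment> \<open>Nonnegativity of the kernel on the diagonal makes the denominator of \<open>c\<^sub>n\<close> positive.\<close>
  have K: "?E ?K \<ge> 0"
  proof -
    have "?E ?K = (\<Sum>k<n. ?E (?H k) * ?E (?H k) / ?N k)"
      by (simp add: qH_kernel_poly_def qdiff_poly_iterate_sum[OF q_neq1]
          qdiff_poly_iterate_smult[OF q_neq1] poly_sum)
    also have "\<dots> \<ge> 0" using N by (intro sum_nonneg divide_nonneg_pos) auto
    finally show ?thesis .
  qed
  have "?E (P n) = ?E (?H n + smult (- (lam * ?E (P n))) ?K)" using Pn by simp
  also have "\<dots> = ?E (?H n) - lam * ?E (P n) * ?E ?K"
    by (simp only: qdiff_poly_iterate_add[OF q_neq1] qdiff_poly_iterate_smult[OF q_neq1] poly_add poly_smult)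
       simp
  finally have "?E (P n) * (1 + lam * ?E ?K) = ?E (?H n)" by (simp add: algebra_simps)
  moreover have "1 + lam * ?E ?K > 0" using K lam by (simp add: add_pos_nonneg)
  ultimately have "?E (P n) = ?E (?H n) / (1 + lam * ?E ?K)" by (simp add: field_simps)
  then have "lam * ?E (P n) = qH_c q \<alpha> lam j (int n)"
    unfolding qH_c_def qH_kernel_eq by (simp add: qdiff_poly_iterate_qHermite)
  then show ?thesis using Pn by simp
qed

section \<open>Representation of the differentiated kernel\<close>

lemma qnum_Suc_pos: "qnum q (int (Suc n)) > 0"
  using qpow_less_1[of n] q_less
  unfolding qnum_of_nat by simp

lemma qfact_pos: "qfact q n > 0"
proof (induction n)
  case 0
  then show ?case by (simp add: qfact_def)
next
  case (Suc n)
  then show ?case unfolding qfact_Suc using qnum_Suc_pos[of n] by simp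
qed

lemma qbinomial_Pascal:
  assumes "k < n"
  shows "qfact q (Suc n) / (qfact q (Suc k) * qfact q (n - k))
    = qfact q n / (qfact q (Suc k) * qfact q (n - Suc k)) + q ^ (n - k) * (qfact q n / (qfact q k * qfact q (n - k)))"
proof -
  obtain l where n: "n = Suc k + l" using assms less_iff_Suc_add by auto
  have [simp]: "Suc (k + l) - k = Suc l" by simp
  define a b f where "a = qfact q k" "b = qfact q l" "f = qfact q n"
  have pos: "a > 0" "b > 0" "f > 0" unfolding a_b_f_def by (rule qfact_pos)+
  define u v w where "u = qnum q (int (Suc k))" "v = qnum q (int (Suc l))" "w = qnum q (int (Suc n))"
  have uv: "u > 0" "v > 0" unfolding u_v_w_def by (rule qnum_Suc_pos)+
  \<comment> \<open>The additive rule \<open>[a + b] = [a] + q\<^sup>a [b]\<close> behind the Pascal rule.\<close>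
  have w: "w = v + q ^ Suc l * u"
    unfolding u_v_w_def qnum_of_nat n using q_less
    by (simp add: power_add field_simps)
  have "f * w / (a * u * (b * v)) = f / (a * u * b) + q ^ Suc l * (f / (a * (b * v)))"
    unfolding w using pos uv by (simp add: field_simps)
  then show ?thesis
    unfolding a_b_f_def u_v_w_def by (simp add: n qfact_Suc del: of_nat_Suc)
qed

text \<open>
  Gauss's \<open>q\<close>-binomial theorem in recursive form: \<open>qsub_power q x y n\<close> is the product
  \<open>(x - y) (x - q y) \<dots> (x - q\<^sup>n\<^sup>-\<^sup>1 y)\<close>.
\<close>

lemma qsub_power_Suc: "qsub_power q x y (Suc n) = (x - q ^ n * y) * qsub_power q x y n"
proof -
  let ?b = "\<lambda>m k. qfact q m / (qfact q k * qfact q (m - k))"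
  let ?t = "\<lambda>k. q ^ (k choose 2) * (- y) ^ k"
  have "qsub_power q x y (Suc n)
      = x ^ Suc n + (\<Sum>k\<le>n. ?b (Suc n) (Suc k) * ?t (Suc k) * x ^ (n - k))"
    unfolding qsub_power_def sum.atMost_Suc_shift
    using qfact_pos[of "Suc n"] by (simp add: qfact_def[of q 0] numeral_2_eq_2 mult_ac)
  also have "\<dots> = x ^ Suc n
      + (\<Sum>k\<le>n. (if k < n then ?b n (Suc k) * ?t (Suc k) * x ^ (n - k) else 0)
              + q ^ (n - k) * ?b n k * ?t (Suc k) * x ^ (n - k))"
  proof (intro arg_cong2[of _ _ _ _ "(+)"] refl sum.cong)
    fix k assume "k \<in> {..n}"
    then consider "k < n" | "k = n" by force
    then show "?b (Suc n) (Suc k) * ?t (Suc k) * x ^ (n - k)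
      = (if k < n then ?b n (Suc k) * ?t (Suc k) * x ^ (n - k) else 0)
              + q ^ (n - k) * ?b n k * ?t (Suc k) * x ^ (n - k)"
    proof cases
      case 1
      have "?b (Suc n) (Suc k) = ?b n (Suc k) + q ^ (n - k) * ?b n k"
        using qbinomial_Pascal[OF 1] by simp
      then have "?b (Suc n) (Suc k) * ?t (Suc k) * x ^ (n - k)
        = (?b n (Suc k) + q ^ (n - k) * ?b n k) * ?t (Suc k) * x ^ (n - k)" by (rule arg_cong)
      then show ?thesis using 1 by (simp only: if_True distrib_right)
    next
      case 2
      then show ?thesis using qfact_pos[of n] qfact_pos[of "Suc n"] by (simp add: qfact_def[of q 0])
    qed
  qed
  also have "\<dots> = (x ^ Suc n + (\<Sum>k<n. ?b n (Suc k) * ?t (Suc k) * x ^ (n - k)))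
      + (\<Sum>k\<le>n. q ^ (n - k) * ?b n k * ?t (Suc k) * x ^ (n - k))"
  proof -
    have "(\<Sum>k\<le>n. (if k < n then ?b n (Suc k) * ?t (Suc k) * x ^ (n - k) else 0))
        = (\<Sum>k<n. ?b n (Suc k) * ?t (Suc k) * x ^ (n - k))"
      by (intro sum.mono_neutral_cong_right) auto
    then show ?thesis unfolding sum.distrib by simp
  qed
  also have "x ^ Suc n + (\<Sum>k<n. ?b n (Suc k) * ?t (Suc k) * x ^ (n - k)) = x * qsub_power q x y n"
  proof -
    have "qsub_power q x y n = x ^ n + (\<Sum>k<n. ?b n (Suc k) * ?t (Suc k) * x ^ (n - Suc k))"
      unfolding qsub_power_def lessThan_Suc_atMost[symmetric] sum.lessThan_Suc_shift
      using qfact_pos[of n] by (simp add: qfact_def[of q 0] numeral_2_eq_2 mult_ac)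
    moreover have "x * x ^ (n - Suc k) = x ^ (n - k)" if "k < n" for k
      using that by (metis Suc_diff_Suc power_Suc)
    ultimately show ?thesis
      by (simp add: distrib_left sum_distrib_left mult.left_commute[of x] mult.assoc)
  qed
  also have "(\<Sum>k\<le>n. q ^ (n - k) * ?b n k * ?t (Suc k) * x ^ (n - k)) = - (q ^ n * y) * qsub_power q x y n"
  proof -
    have "q ^ (n - k) * ?b n k * ?t (Suc k) * x ^ (n - k)
        = - (q ^ n * y) * (?b n k * q ^ (k choose 2) * (- y) ^ k * x ^ (n - k))" if "k \<le> n" for k
    proof -
      have "q ^ (n - k) * q ^ k = q ^ n" using that by (simp flip: power_add)
      then have "q ^ (n - k) * ?t (Suc k) = - (q ^ n * y) * (q ^ (k choose 2) * (- y) ^ k)"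
        by (simp add: choose2_Suc power_add)
      then have "?b n k * x ^ (n - k) * (q ^ (n - k) * ?t (Suc k))
        = ?b n k * x ^ (n - k) * (- (q ^ n * y) * (q ^ (k choose 2) * (- y) ^ k))" by (rule arg_cong)
      then show ?thesis by (simp only: mult_ac)
    qed
    then show ?thesis unfolding qsub_power_def sum_distrib_left by (intro sum.cong) auto
  qed
  finally show ?thesis by (simp add: algebra_simps)
qed

lemma qsub_power_0: "qsub_power q x y 0 = 1"
  by (simp add: qsub_power_def qfact_def numeral_2_eq_2)

text \<open>
  The classical telescoping of the three-term recurrence, written as an identity of polynomials in
  the second variable because the \<open>q\<close>-derivatives with respect to that variable are needed.
\<close>

lemma Christoffel_Darboux:
  "[:x, -1:] * (\<Sum>k<Suc m. smult (poly (qHermite q (int k)) x / qH_norm2 q (int k)) (qHermite q (int k)))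
   = smult (1 / qH_norm2 q (int m)) (smult (poly (qHermite q (int (Suc m))) x) (qHermite q (int m))
       - smult (poly (qHermite q (int m)) x) (qHermite q (int (Suc m))))"
proof -
  let ?H = "\<lambda>k. poly (qHermite q (int k))" and ?N = "\<lambda>k. qH_norm2 q (int k)"
  have N: "?N k > 0" for k by (rule qH_norm2_pos)
  have CD: "(x - y) * (\<Sum>k<Suc m. ?H k x * ?H k y / ?N k)
      = (?H (Suc m) x * ?H m y - ?H m x * ?H (Suc m) y) / ?N m" for y
  proof (induction m)
    case 0
    then show ?case
      using qHermite_0 qHermite_1 by simp
  next
    case (Suc m)
    define g where "g = q ^ m * (1 - q ^ Suc m)"
    have g: "g > 0" unfolding g_def using q_pos qpow_less_1[of m] by simp
    have three: "z * ?H (Suc m) z = ?H (Suc (Suc m)) z + g * ?H m z" for z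
      using arg_cong[OF qHermite_three_term[of m], of "\<lambda>p. poly p z"]
      by (simp add: g_def del: of_nat_Suc)
    have NS: "?N (Suc m) = g * ?N m" unfolding g_def by (rule qH_norm2_Suc)
    have "(x - y) * (\<Sum>k<Suc (Suc m). ?H k x * ?H k y / ?N k)
        = (?H (Suc m) x * ?H m y - ?H m x * ?H (Suc m) y) / ?N m
          + (x - y) * (?H (Suc m) x * ?H (Suc m) y / ?N (Suc m))"
      unfolding sum.lessThan_Suc[of _ "Suc m"] distrib_left Suc ..
    also have "\<dots> = (g * (?H (Suc m) x * ?H m y - ?H m x * ?H (Suc m) y)
         + ((x * ?H (Suc m) x) * ?H (Suc m) y - ?H (Suc m) x * (y * ?H (Suc m) y))) / ?N (Suc m)"
      unfolding NS using g N[of m] by (simp add: field_simps)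
    also have "\<dots> = (?H (Suc (Suc m)) x * ?H (Suc m) y - ?H (Suc m) x * ?H (Suc (Suc m)) y) / ?N (Suc m)"
      unfolding three by (simp add: algebra_simps)
    finally show ?case .
  qed
  have "poly ([:x, -1:] * (\<Sum>k<Suc m. smult (?H k x / ?N k) (qHermite q (int k)))) y
   = poly (smult (1 / ?N m) (smult (?H (Suc m) x) (qHermite q (int m))
       - smult (?H m x) (qHermite q (int (Suc m))))) y" for y
    using CD[of y]
    by (simp add: poly_sum algebra_simps diff_divide_distrib del: of_nat_Suc sum.lessThan_Suc)
  then show ?thesis using poly_eq_poly_eq_iff by blast
qed

text \<open>
  The \<open>q\<close>-Leibniz rule for a linear factor: only the first derivative of the factor survives, and
  each differentiation dilates the node once more.
\<close>

lemma qdiff_poly_iterate_linear_mult: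
  "(qdiff_poly q ^^ Suc k) ([:x, -1:] * G)
     = [:x, - (q ^ Suc k):] * (qdiff_poly q ^^ Suc k) G - smult (qnum q (int (Suc k))) ((qdiff_poly q ^^ k) G)"
proof -
  have step: "qdiff_poly q ([:x, - c:] * F) = [:x, - (q * c):] * qdiff_poly q F - smult c F" for c F
  proof -
    have "qdiff_poly q [:x, - c:] = [:- c:]"
      by (rule qdiff_poly_unique[OF q_neq1]) (simp add: pcompose_pCons algebra_simps)
    then show ?thesis
      unfolding qdiff_poly_mult[OF q_neq1] by (simp add: pcompose_pCons mult.commute)
  qed
  have diff: "qdiff_poly q (p - r) = qdiff_poly q p - qdiff_poly q r" for p r
    using qdiff_poly_add[OF q_neq1, of "p - r" r] by simp
  show ?thesis
  proof (induction k)
    case 0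
    then show ?case using step[of 1 G] q_less by (simp add: qnum_def)
  next
    case (Suc k)
    have num: "q ^ Suc k + qnum q (int (Suc k)) = qnum q (int (Suc (Suc k)))"
      unfolding qnum_of_nat using q_less by (simp add: field_simps)
    let ?F = "(qdiff_poly q ^^ Suc k) G"
    have "(qdiff_poly q ^^ Suc (Suc k)) ([:x, -1:] * G)
        = qdiff_poly q ([:x, - (q ^ Suc k):] * ?F - smult (qnum q (int (Suc k))) ((qdiff_poly q ^^ k) G))"
      using Suc by simp
    also have "\<dots> = [:x, - (q ^ Suc (Suc k)):] * qdiff_poly q ?F
        - (smult (q ^ Suc k) ?F + smult (qnum q (int (Suc k))) ?F)"
      unfolding diff step qdiff_poly_smult[OF q_neq1] by simp
    also have "smult (q ^ Suc k) ?F + smult (qnum q (int (Suc k))) ?F = smult (qnum q (int (Suc (Suc k)))) ?F"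
      unfolding num[symmetric] by (rule smult_add_left[symmetric])
    finally show ?case by simp
  qed
qed

text \<open>
  The partial sum on the left is a \<open>q\<close>-Taylor polynomial of \<open>(x - y) G(y)\<close>.  Inserting the Leibniz rule,
  consecutive terms cancel because \<open>qsub_power\<close> acquires exactly the factor \<open>x - q\<^sup>k y\<close>.  Solving for
  the derivative of \<open>G\<close> replaces differentiating a quotient by \<open>x - y\<close>.
\<close>

lemma qderiv_telescope:
  "(\<Sum>k\<le>j. poly ((qdiff_poly q ^^ k) ([:x, -1:] * G)) y / qfact q k * qsub_power q x y k)
     = qsub_power q x y (Suc j) * poly ((qdiff_poly q ^^ j) G) y / qfact q j"
proof (induction j)
  case 0
  then show ?case by (simp add: qsub_power_Suc qsub_power_0 qfact_def algebra_simps)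
next
  case (Suc j)
  have pos: "qfact q j > 0" "qnum q (int (Suc j)) > 0" by (rule qfact_pos qnum_Suc_pos)+
  have "qsub_power q x y (Suc j) * poly ((qdiff_poly q ^^ j) G) y / qfact q j
      + poly ((qdiff_poly q ^^ Suc j) ([:x, -1:] * G)) y / qfact q (Suc j) * qsub_power q x y (Suc j)
    = qsub_power q x y (Suc (Suc j)) * poly ((qdiff_poly q ^^ Suc j) G) y / qfact q (Suc j)"
    unfolding qdiff_poly_iterate_linear_mult qsub_power_Suc[of x y "Suc j"] qfact_Suc
    using pos by (simp add: field_simps del: of_nat_Suc funpow.simps)
  then show ?case using Suc by (simp only: sum.atMost_Suc)
qed

text \<open>
  Apply the telescoping identity to \<open>G(y) = K\<^sub>n\<^sub>-\<^sub>1(x, y)\<close>, for which Christoffel--Darboux makes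
  \<open>(x - y) G(y)\<close> a combination of \<open>H\<^sub>n(y)\<close> and \<open>H\<^sub>n\<^sub>-\<^sub>1(y)\<close>.  For \<open>n = 0\<close> both sides are \<open>0\<close>, since the
  zero norm of index \<open>-1\<close> makes both coefficients vanish.
\<close>

theorem qH_kernel_representation:
  assumes "qsub_power q x y (j + 1) \<noteq> 0"
  shows "poly (qH_kernel_poly q j y n) x
     = qH_A q j (int n) x y * poly (qHermite q (int n)) x + qH_B q j (int n) x y * poly (qHermite q (int n - 1)) x"
proof (cases n)
  case 0
  then show ?thesis by (simp add: qH_kernel_poly_def qH_A_def qH_B_def qH_norm2_def)
next
  case (Suc m)
  let ?H = "\<lambda>k. qHermite q (int k)" and ?N = "\<lambda>k. qH_norm2 q (int k)"
  let ?D = "\<lambda>k p. poly ((qdiff_poly q ^^ k) p) y"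
  let ?G = "\<Sum>k<Suc m. smult (poly (?H k) x / ?N k) (?H k)"
  let ?s = "qsub_power q x y"
  let ?S = "\<lambda>p. \<Sum>k\<le>j. ?D k p / qfact q k * ?s k"
  have K: "poly (qH_kernel_poly q j y n) x = ?D j ?G"
    unfolding qH_kernel_poly_def Suc
    by (simp add: poly_sum qdiff_poly_iterate_sum[OF q_neq1] qdiff_poly_iterate_smult[OF q_neq1]
        qdiff_poly_iterate_add[OF q_neq1] mult_ac)
  have lin: "?D k (smult c (smult a p - smult b r)) = c * (a * ?D k p - b * ?D k r)" for k c a b p r
  proof -
    have "smult c (smult a p - smult b r) = smult c (smult a p + smult (- b) r)" by simp
    then show ?thesis
      by (simp only: qdiff_poly_iterate_smult[OF q_neq1] qdiff_poly_iterate_add[OF q_neq1] poly_smult poly_add) simp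
  qed
  have "?s (Suc j) * ?D j ?G / qfact q j = ?S ([:x, -1:] * ?G)"
    by (rule qderiv_telescope[symmetric])
  also have "\<dots> = (\<Sum>k\<le>j. poly (?H (Suc m)) x / ?N m * (?D k (?H m) / qfact q k * ?s k)
                   - poly (?H m) x / ?N m * (?D k (?H (Suc m)) / qfact q k * ?s k))"
    unfolding Christoffel_Darboux lin by (intro sum.cong) (auto simp: algebra_simps diff_divide_distrib)
  also have "\<dots> = poly (?H (Suc m)) x / ?N m * ?S (?H m) - poly (?H m) x / ?N m * ?S (?H (Suc m))"
    by (simp only: sum_subtractf sum_distrib_left)
  finally have "?D j ?G = qfact q j / ?s (Suc j) *
      (poly (?H (Suc m)) x / ?N m * ?S (?H m) - poly (?H m) x / ?N m * ?S (?H (Suc m)))"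
    using assms qfact_pos[of j] by (simp add: field_simps)
  then have DG: "?D j ?G = qfact q j / (?N m * ?s (Suc j)) * ?S (?H m) * poly (?H (Suc m)) x
      + - (qfact q j / (?N m * ?s (Suc j))) * ?S (?H (Suc m)) * poly (?H m) x"
    by (simp add: right_diff_distrib mult_ac del: sum.lessThan_Suc of_nat_Suc)
  have n: "int (Suc m) - 1 = int m" by simp
  show ?thesis
    unfolding K
    unfolding DG qH_A_def qH_B_def qderiv_iterate_poly[OF q_neq1] Suc n Suc_eq_plus1[symmetric] ..
qed

end

section \<open>Differentiating the representation\<close>

text \<open>
  At the origin the \<open>q\<close>-derivative is an ordinary derivative, and the coefficients \<open>C\<^sub>1\<close>, \<open>D\<^sub>1\<close>, which
  are themselves given by \<open>q\<close>-derivatives, must be differentiated there.  Rational functions without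
  a pole at the origin form a class that is closed under everything needed, including the
  \<open>q\<close>-derivative, and whose members are differentiable at the origin.
\<close>

definition rational_near_0 :: "(real \<Rightarrow> real) \<Rightarrow> bool" where
  "rational_near_0 f \<longleftrightarrow> (\<exists>u v. poly v 0 \<noteq> 0 \<and> (\<forall>\<^sub>F x in nhds 0. f x = poly u x / poly v x))"

lemma poly_eventually_nonzero:
  fixes v :: "real poly"
  assumes "poly v 0 \<noteq> 0"
  shows "\<forall>\<^sub>F x in nhds 0. poly v x \<noteq> 0"
proof -
  have "(poly v \<longlongrightarrow> poly v 0) (nhds 0)"
    using isContD[of 0 "poly v"] by (simp add: tendsto_nhds_iff)
  then show ?thesis using assms tendsto_imp_eventually_ne by blast
qed

lemma eventually_nhds_0_scale:
  assumes "\<forall>\<^sub>F x in nhds (0::real). Q x"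
  shows "\<forall>\<^sub>F x in nhds 0. Q (c * x)"
proof -
  have "((\<lambda>x. c * x) \<longlongrightarrow> c * 0) (nhds 0)" by (intro tendsto_intros filterlim_ident)
  then show ?thesis using assms by (simp add: filterlim_iff)
qed

lemma rational_near_0_quotient:
  assumes "poly v 0 \<noteq> 0"
  shows "rational_near_0 (\<lambda>x. poly u x / poly v x)"
  using assms unfolding rational_near_0_def by (intro exI[of _ u] exI[of _ v]) auto

lemma rational_near_0_poly: "rational_near_0 (poly p)"
  using rational_near_0_quotient[of 1 p] by simp

lemma rational_near_0_add:
  assumes "rational_near_0 f" "rational_near_0 g"
  shows "rational_near_0 (\<lambda>x. f x + g x)"
proof -
  obtain u v where u: "poly v 0 \<noteq> 0" "\<forall>\<^sub>F x in nhds 0. f x = poly u x / poly v x"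
    using assms(1) unfolding rational_near_0_def by blast
  obtain u' v' where u': "poly v' 0 \<noteq> 0" "\<forall>\<^sub>F x in nhds 0. g x = poly u' x / poly v' x"
    using assms(2) unfolding rational_near_0_def by blast
  have "\<forall>\<^sub>F x in nhds 0. f x + g x = poly (u * v' + u' * v) x / poly (v * v') x"
    using u(2) u'(2) poly_eventually_nonzero[OF u(1)] poly_eventually_nonzero[OF u'(1)]
    by eventually_elim (simp add: field_simps)
  moreover have "poly (v * v') 0 \<noteq> 0" using u u' by simp
  ultimately show ?thesis unfolding rational_near_0_def by blast
qed

lemma rational_near_0_mult:
  assumes "rational_near_0 f" "rational_near_0 g"
  shows "rational_near_0 (\<lambda>x. f x * g x)"
proof -
  obtain u v where u: "poly v 0 \<noteq> 0" "\<forall>\<^sub>F x in nhds 0. f x = poly u x / poly v x"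
    using assms(1) unfolding rational_near_0_def by blast
  obtain u' v' where u': "poly v' 0 \<noteq> 0" "\<forall>\<^sub>F x in nhds 0. g x = poly u' x / poly v' x"
    using assms(2) unfolding rational_near_0_def by blast
  have "\<forall>\<^sub>F x in nhds 0. f x * g x = poly (u * u') x / poly (v * v') x"
    using u(2) u'(2) by eventually_elim simp
  moreover have "poly (v * v') 0 \<noteq> 0" using u u' by simp
  ultimately show ?thesis unfolding rational_near_0_def by blast
qed

lemma rational_near_0_scale:
  assumes "rational_near_0 f"
  shows "rational_near_0 (\<lambda>x. f (c * x))"
proof -
  obtain u v where u: "poly v 0 \<noteq> 0" "\<forall>\<^sub>F x in nhds 0. f x = poly u x / poly v x"
    using assms(1) unfolding rational_near_0_def by blast
  have "\<forall>\<^sub>F x in nhds 0. f (c * x) = poly (pcompose u [:0, c:]) x / poly (pcompose v [:0, c:]) x"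
    using eventually_nhds_0_scale[OF u(2), of c] by eventually_elim (simp add: poly_pcompose mult.commute)
  moreover have "poly (pcompose v [:0, c:]) 0 \<noteq> 0" using u by (simp add: poly_pcompose)
  ultimately show ?thesis unfolding rational_near_0_def by blast
qed

lemma rational_near_0_deriv:
  assumes "poly v 0 \<noteq> 0" "\<forall>\<^sub>F x in nhds 0. f x = poly u x / poly v x"
  shows "(f has_real_derivative (poly (pderiv u) 0 * poly v 0 - poly u 0 * poly (pderiv v) 0) / (poly v 0 * poly v 0)) (at 0)"
proof -
  have "((\<lambda>x. poly u x / poly v x) has_real_derivative
      (poly (pderiv u) 0 * poly v 0 - poly u 0 * poly (pderiv v) 0) / (poly v 0 * poly v 0)) (at 0)"
    using assms(1) by (intro DERIV_divide poly_DERIV)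
  then show ?thesis using DERIV_cong_ev[OF refl assms(2) refl] by blast
qed

lemma rational_near_0_DERIV:
  assumes "rational_near_0 f"
  shows "(f has_real_derivative deriv f 0) (at 0)"
  proof -
  obtain u v where "poly v 0 \<noteq> 0" "\<forall>\<^sub>F x in nhds 0. f x = poly u x / poly v x"
    using assms unfolding rational_near_0_def by blast
  from rational_near_0_deriv[OF this] show ?thesis using DERIV_imp_deriv by fastforce
qed

text \<open>
  The quotient rule \<open>D\<^sub>q(u / v)(x) = (D\<^sub>q u(x) v(x) - u(x) D\<^sub>q v(x)) / (v(x) v(q x))\<close> holds for \<open>x \<noteq> 0\<close> by
  computation and for \<open>x = 0\<close> by the classical quotient rule: the singularity is removed with the
  correct value.
\<close>

lemma rational_near_0_qderiv:
  assumes q: "q \<noteq> 1" and f: "rational_near_0 f"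
  shows "rational_near_0 (qderiv q f)"
proof -
  obtain u v where v: "poly v 0 \<noteq> 0" and uv: "\<forall>\<^sub>F x in nhds 0. f x = poly u x / poly v x"
    using f unfolding rational_near_0_def by blast
  let ?D = "qdiff_poly q"
  let ?u = "?D u * v - u * ?D v" and ?v = "v * pcompose v [:0, q:]"
  have "\<forall>\<^sub>F x in nhds 0. qderiv q f x = poly ?u x / poly ?v x"
    using uv eventually_nhds_0_scale[OF uv, of q] poly_eventually_nonzero[OF v]
      eventually_nhds_0_scale[OF poly_eventually_nonzero[OF v], of q]
  proof eventually_elim
    case (elim x)
    show ?case
    proof (cases "x = 0")
      case True
      have D0: "poly (?D p) 0 = poly (pderiv p) 0" for p
        using fun_cong[OF qderiv_poly[OF q, of p], of 0] DERIV_imp_deriv[OF poly_DERIV[of p 0]]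
        by (simp add: qderiv_def)
      show ?thesis
        using True DERIV_imp_deriv[OF rational_near_0_deriv[OF v uv]]
        by (simp add: qderiv_def D0 poly_pcompose)
    next
      case False
      let ?w = "(q - 1) * x"
      have w: "?w \<noteq> 0" using False q by simp
      have "f (q * x) - f x = (poly u (q * x) * poly v x - poly u x * poly v (q * x)) / (poly v x * poly v (q * x))"
        using elim by (simp add: field_simps)
      also have "poly u (q * x) = poly u x + ?w * poly (?D u) x"
        using poly_qdiff_poly[OF q, of x u] by simp
      also have "(poly u x + ?w * poly (?D u) x) * poly v x - poly u x * poly v (q * x)
          = ?w * poly ?u x"
      proof -
        have "poly v (q * x) = poly v x + ?w * poly (?D v) x"
          using poly_qdiff_poly[OF q, of x v] by simp
        then show ?thesis by (simp only: poly_diff poly_mult) (simp add: algebra_simps)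
      qed
      finally show ?thesis
        using False w by (simp add: qderiv_def poly_pcompose mult.commute[of x q])
    qed
  qed
  moreover have "poly ?v 0 \<noteq> 0" using v by (simp add: poly_pcompose)
  ultimately show ?thesis unfolding rational_near_0_def by blast
qed

context q_base
begin

lemma poly_qsub_power: "qsub_power q x y k = poly (\<Prod>i<k. [:- (q ^ i * y), 1:]) x"
  by (induction k) (simp_all add: qsub_power_0 qsub_power_Suc left_diff_distrib mult_ac)

lemma qsub_power_at_0:
  assumes "y \<noteq> 0"
  shows "qsub_power q 0 y k \<noteq> 0"
  using assms q_pos by (simp add: poly_qsub_power poly_prod)

lemma rational_near_0_qsub_ratio:
  assumes "y \<noteq> 0"
  shows "rational_near_0 (\<lambda>x. c / (d * qsub_power q x y m) * (\<Sum>k\<le>j. g k * qsub_power q x y k))"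
proof -
  let ?s = "\<lambda>k. \<Prod>i<k. [:- (q ^ i * y), 1:]"
  have "rational_near_0 (\<lambda>x. poly (\<Sum>k\<le>j. smult (c / d * g k) (?s k)) x / poly (?s m) x)"
    using qsub_power_at_0[OF assms, of m] unfolding poly_qsub_power by (rule rational_near_0_quotient)
  then show ?thesis
    unfolding poly_qsub_power by (simp add: poly_sum sum_distrib_left sum_divide_distrib mult_ac)
qed

lemma rational_near_0_qH_A: "y \<noteq> 0 \<Longrightarrow> rational_near_0 (\<lambda>x. qH_A q j n x y)"
  unfolding qH_A_def by (rule rational_near_0_qsub_ratio)

lemma rational_near_0_qH_B: "y \<noteq> 0 \<Longrightarrow> rational_near_0 (\<lambda>x. qH_B q j n x y)"
  unfolding qH_B_def minus_divide_left by (rule rational_near_0_qsub_ratio)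

lemma rational_near_0_qH_C1:
  assumes "y \<noteq> 0"
  shows "rational_near_0 (\<lambda>x. qH_C1 q j n x y)"
proof -
  have "rational_near_0 (\<lambda>x. qderiv q (\<lambda>t. qH_A q j n t y) x
      + poly [:- (qnum q (n - 1) / qH_gamma q (n - 1)):] x * qH_B q j n (q * x) y)"
    by (intro rational_near_0_add rational_near_0_mult rational_near_0_poly
        rational_near_0_qderiv[OF q_neq1] rational_near_0_qH_A[OF assms]
        rational_near_0_scale[OF rational_near_0_qH_B[OF assms]])
  then show ?thesis by (simp add: qH_C1_def)
qed

lemma rational_near_0_qH_D1:
  assumes "y \<noteq> 0"
  shows "rational_near_0 (\<lambda>x. qH_D1 q j n x y)"
proof -
  have "rational_near_0 (\<lambda>x. poly [:qnum q n:] x * qH_A q j n (q * x) y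
      + poly [:0, qnum q (n - 1) / qH_gamma q (n - 1):] x * qH_B q j n (q * x) y
      + qderiv q (\<lambda>t. qH_B q j n t y) x)"
    by (intro rational_near_0_add rational_near_0_mult rational_near_0_poly
        rational_near_0_qderiv[OF q_neq1] rational_near_0_qH_B[OF assms]
        rational_near_0_scale[OF rational_near_0_qH_A[OF assms]] rational_near_0_scale[OF rational_near_0_qH_B[OF assms]])
  then show ?thesis by (simp add: qH_D1_def mult.commute)
qed

text \<open>
  Lowering \<open>H\<^sub>n\<^sub>-\<^sub>1\<close> produces \<open>H\<^sub>n\<^sub>-\<^sub>2\<close>, which the three-term recurrence expresses through \<open>H\<^sub>n\<close> and
  \<open>H\<^sub>n\<^sub>-\<^sub>1\<close>.  For \<open>n = 1\<close> both sides vanish, the right one through \<open>[0]\<^sub>q = 0\<close>.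
\<close>

lemma qdiff_poly_qHermite_pred:
  assumes "n \<ge> 1"
  shows "qdiff_poly q (qHermite q (n - 1)) =
    smult (qnum q (n - 1) / qH_gamma q (n - 1)) ([:0, 1:] * qHermite q (n - 1) - qHermite q n)"
proof -
  obtain m where n: "n = 1 + int m" using assms zle_iff_zadd by blast
  show ?thesis
  proof (cases m)
    case 0
    then show ?thesis
      using n by (simp add: qdiff_poly_qHermite qnum_def)
  next
    case (Suc k)
    have n': "n = int (Suc (Suc k))" "int (Suc (Suc k)) - 1 = int (Suc k)" "int (Suc k) - 1 = int k"
      using n Suc by auto
    have g: "qH_gamma q (int (Suc k)) = q ^ k * (1 - q ^ Suc k)"
      unfolding qH_gamma_def power_int_of_nat by simp
    have "q ^ k * (1 - q ^ Suc k) \<noteq> 0" using q_pos qpow_less_1[of k] by auto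
    then show ?thesis
      unfolding qdiff_poly_qHermite n' g
      unfolding qHermite_three_term by (simp del: of_nat_Suc power_Suc)
  qed
qed

text \<open>
  The \<open>q\<close>-product rule applied to \<open>a H\<^sub>n + b H\<^sub>n\<^sub>-\<^sub>1\<close> leaves this form unchanged, since \<open>D\<^sub>q H\<^sub>n\<close> and
  \<open>D\<^sub>q H\<^sub>n\<^sub>-\<^sub>1\<close> are combinations of the same two polynomials.  It gives the passage from
  \<open>A\<close>, \<open>B\<close> to \<open>C\<^sub>1\<close>, \<open>D\<^sub>1\<close> and from there to \<open>C\<^sub>2\<close>, \<open>D\<^sub>2\<close>.  The representation of \<open>G\<close> is assumed at
  the two points \<open>t\<close> and \<open>q t\<close> of the difference quotient, and near the origin for the case \<open>t = 0\<close>.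
\<close>

lemma qderiv_Hermite_combination:
  assumes n: "n \<ge> 1"
    and rat: "rational_near_0 a" "rational_near_0 b"
    and near: "\<forall>\<^sub>F s in nhds 0. poly G s = a s * poly (qHermite q n) s + b s * poly (qHermite q (n - 1)) s"
    and at: "poly G t = a t * poly (qHermite q n) t + b t * poly (qHermite q (n - 1)) t"
    and atq: "poly G (q * t) = a (q * t) * poly (qHermite q n) (q * t) + b (q * t) * poly (qHermite q (n - 1)) (q * t)"
  shows "poly (qdiff_poly q G) t
     = (qderiv q a t - qnum q (n - 1) / qH_gamma q (n - 1) * b (q * t)) * poly (qHermite q n) t
     + (qnum q n * a (q * t) + qnum q (n - 1) / qH_gamma q (n - 1) * t * b (q * t) + qderiv q b t)
         * poly (qHermite q (n - 1)) t"
proof -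
  define h g where "h = qHermite q n" and "g = qHermite q (n - 1)"
  define \<kappa> where "\<kappa> = qnum q (n - 1) / qH_gamma q (n - 1)"
  have Dh: "poly (qdiff_poly q h) t = qnum q n * poly g t"
    unfolding h_def g_def qdiff_poly_qHermite by simp
  have Dg: "poly (qdiff_poly q g) t = \<kappa> * (t * poly g t - poly h t)"
    unfolding h_def g_def \<kappa>_def qdiff_poly_qHermite_pred[OF n] by simp
  have "poly (qdiff_poly q G) t
     = (qderiv q a t - \<kappa> * b (q * t)) * poly h t
     + (qnum q n * a (q * t) + \<kappa> * t * b (q * t) + qderiv q b t) * poly g t"
  proof (cases "t = 0")
    case True
    have D: "(poly p has_real_derivative poly (qdiff_poly q p) 0) (at 0)" for p
      using fun_cong[OF qderiv_poly[OF q_neq1, of p], of 0] DERIV_imp_deriv[OF poly_DERIV[of p 0]]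
         poly_DERIV[of p 0] by (simp add: qderiv_def)
    have "((\<lambda>s. a s * poly h s + b s * poly g s) has_real_derivative
        (deriv a 0 * poly h 0 + poly (qdiff_poly q h) 0 * a 0)
        + (deriv b 0 * poly g 0 + poly (qdiff_poly q g) 0 * b 0)) (at 0)"
      by (intro DERIV_add DERIV_mult D rational_near_0_DERIV rat)
    then have "(poly G has_real_derivative
        (deriv a 0 * poly h 0 + poly (qdiff_poly q h) 0 * a 0)
        + (deriv b 0 * poly g 0 + poly (qdiff_poly q g) 0 * b 0)) (at 0)"
      using DERIV_cong_ev[OF refl near[folded h_def g_def] refl] by blast
    from DERIV_unique[OF D this] show ?thesis
      using Dh Dg True by (simp add: qderiv_def algebra_simps)
  next
    case False
    let ?w = "(q - 1) * t"
    have w: "?w \<noteq> 0" using False q_neq1 by simp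
    have hq: "poly h (q * t) = poly h t + ?w * (qnum q n * poly g t)"
      using poly_qdiff_poly[OF q_neq1, of t h] Dh by simp
    have gq: "poly g (q * t) = poly g t + ?w * (\<kappa> * (t * poly g t - poly h t))"
      using poly_qdiff_poly[OF q_neq1, of t g] Dg by simp
    have aq: "a (q * t) = a t + ?w * qderiv q a t" and bq: "b (q * t) = b t + ?w * qderiv q b t"
      using False w by (simp_all add: qderiv_def)
    have "?w * poly (qdiff_poly q G) t = poly G (q * t) - poly G t"
      by (rule poly_qdiff_poly[OF q_neq1])
    also have "\<dots> = (a (q * t) * poly h (q * t) + b (q * t) * poly g (q * t)) - (a t * poly h t + b t * poly g t)"
      unfolding at atq h_def g_def ..
    also have "\<dots> = (a (q * t) - a t) * poly h t + (b (q * t) - b t) * poly g t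
       + a (q * t) * (?w * (qnum q n * poly g t)) + b (q * t) * (?w * (\<kappa> * (t * poly g t - poly h t)))"
      unfolding hq gq by (simp only: algebra_simps)
    also have "a (q * t) - a t = ?w * qderiv q a t" using aq by simp
    also have "b (q * t) - b t = ?w * qderiv q b t" using bq by simp
    also have "?w * qderiv q a t * poly h t + ?w * qderiv q b t * poly g t
       + a (q * t) * (?w * (qnum q n * poly g t)) + b (q * t) * (?w * (\<kappa> * (t * poly g t - poly h t)))
       = ?w * ((qderiv q a t - \<kappa> * b (q * t)) * poly h t
     + (qnum q n * a (q * t) + \<kappa> * t * b (q * t) + qderiv q b t) * poly g t)"
      by (simp only: algebra_simps)
    finally show ?thesis using w by simp
  qed
  then show ?thesis unfolding h_def g_def \<kappa>_def .
qed

lemma eventually_qsub_power_nonzero: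
  assumes "y \<noteq> 0"
  shows "\<forall>\<^sub>F s in nhds 0. qsub_power q s y m \<noteq> 0"
  using poly_eventually_nonzero qsub_power_at_0[OF assms, of m] unfolding poly_qsub_power by blast

lemma qdiff_qH_kernel_representation:
  assumes y: "y \<noteq> 0" and n: "n \<ge> 1"
    and reg: "qsub_power q t y (j + 1) \<noteq> 0" "qsub_power q (q * t) y (j + 1) \<noteq> 0"
  shows "poly (qdiff_poly q (qH_kernel_poly q j y n)) t
     = qH_C1 q j (int n) t y * poly (qHermite q (int n)) t + qH_D1 q j (int n) t y * poly (qHermite q (int n - 1)) t"
proof -
  have near: "\<forall>\<^sub>F s in nhds 0. poly (qH_kernel_poly q j y n) s =
      qH_A q j (int n) s y * poly (qHermite q (int n)) s + qH_B q j (int n) s y * poly (qHermite q (int n - 1)) s"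
    using eventually_qsub_power_nonzero[OF y, of "j + 1"]
    by eventually_elim (rule qH_kernel_representation)
  have "int n \<ge> 1" using n by simp
  from qderiv_Hermite_combination[OF this rational_near_0_qH_A[OF y] rational_near_0_qH_B[OF y] near
      qH_kernel_representation[OF reg(1)] qH_kernel_representation[OF reg(2)]]
  show ?thesis by (simp only: qH_C1_def qH_D1_def)
qed

lemma qdiff2_qH_kernel_representation:
  assumes y: "y \<noteq> 0" and n: "n \<ge> 1"
    and reg: "qsub_power q t y (j + 1) \<noteq> 0" "qsub_power q (q * t) y (j + 1) \<noteq> 0"
      "qsub_power q (q * (q * t)) y (j + 1) \<noteq> 0"
  shows "poly (qdiff_poly q (qdiff_poly q (qH_kernel_poly q j y n))) t
     = qH_C2 q j (int n) t y * poly (qHermite q (int n)) t + qH_D2 q j (int n) t y * poly (qHermite q (int n - 1)) t"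
proof -
  note nz = eventually_qsub_power_nonzero[OF y, of "j + 1"]
  have near: "\<forall>\<^sub>F s in nhds 0. poly (qdiff_poly q (qH_kernel_poly q j y n)) s =
      qH_C1 q j (int n) s y * poly (qHermite q (int n)) s + qH_D1 q j (int n) s y * poly (qHermite q (int n - 1)) s"
    using nz eventually_nhds_0_scale[OF nz, of q]
    by eventually_elim (rule qdiff_qH_kernel_representation[OF y n])
  have "int n \<ge> 1" using n by simp
  from qderiv_Hermite_combination[OF this rational_near_0_qH_C1[OF y] rational_near_0_qH_D1[OF y] near
      qdiff_qH_kernel_representation[OF y n reg(1,2)] qdiff_qH_kernel_representation[OF y n reg(2,3)]]
  show ?thesis by (simp only: qH_C2_def qH_D2_def)
qed

end

section \<open>The q-difference equation\<close>

text \<open>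
  Let \<open>m\<^sub>i\<^sub>k = E\<^sub>i F\<^sub>k - E\<^sub>k F\<^sub>i\<close>.  By the Pluecker relation the coefficient of \<open>f\<close> equals
  \<open>m\<^sub>1\<^sub>2 m\<^sub>3\<^sub>5\<close>, so the sum is \<open>m\<^sub>1\<^sub>2\<close> times the expansion of the \<open>3 \<times> 3\<close> determinant with rows
  \<open>(E\<^sub>1, F\<^sub>1, f)\<close>, \<open>(E\<^sub>3, F\<^sub>3, f\<^sub>1)\<close>, \<open>(E\<^sub>5, F\<^sub>5, f\<^sub>2)\<close>, whose last column depends on the first two.
\<close>

lemma second_order_elimination:
  fixes h g f f1 f2 :: real
  assumes "f = E1 * h + F1 * g" "f1 = E3 * h + F3 * g" "f2 = E5 * h + F5 * g"
  shows "(E1 * F3 - E3 * F1) * (E1 * F2 - E2 * F1) * f2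
    + - (E1 * F5 - E5 * F1) * (E1 * F2 - E2 * F1) * f1
    + (- (E2 * F3 - E3 * F2) * (E1 * F5 - E5 * F1) - - (E2 * F5 - E5 * F2) * (E1 * F3 - E3 * F1)) * f = 0"
  unfolding assms by (simp add: algebra_simps)

text \<open>
  \<open>D\<^sub>1\<^sub>/\<^sub>q\<close> at \<open>q t\<close> and \<open>D\<^sub>q\<close> at \<open>t\<close> are the same difference quotient over the pair \<open>t\<close>, \<open>q t\<close>;
  at the origin both are the derivative.
\<close>

lemma qderiv_inverse_poly:
  assumes "0 < q" "q < 1"
  shows "qderiv (inverse q) (poly p) (q * t) = poly (qdiff_poly q p) t"
proof (cases "t = 0")
  case True
  then show ?thesis
    using fun_cong[OF qderiv_poly[of q p], of 0] assms by (simp add: qderiv_def)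
next
  case False
  have 1: "inverse q * (q * t) = t" "(inverse q - 1) * (q * t) = - ((q - 1) * t)"
    using assms by (simp_all add: field_simps)
  have 2: "(q - 1) * t \<noteq> 0" "q * t \<noteq> 0" using False assms by auto
  have "poly p t - poly p (q * t) = - ((q - 1) * t) * poly (qdiff_poly q p) t"
    using poly_qdiff_poly[of q t p] assms by simp
  then have "(poly p t - poly p (q * t)) / - ((q - 1) * t) = poly (qdiff_poly q p) t"
    using 2(1) by simp
  then show ?thesis unfolding qderiv_def 1 using 2(2) by (simp only: if_False)
qed

theorem theorem3:
  fixes q \<alpha> lam x :: real and j n :: nat and P :: "nat \<Rightarrow> real poly"
  assumes "0 < q" and "q < 1"
    and "\<alpha> \<notin> {-1..1}"
    and "lam > 0"
    and "qH_Sobolev_seq q \<alpha> lam j P"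
    and "qH_regular q \<alpha> j x"
  shows "qH_Rbar q \<alpha> lam j (int n) x * qderiv (inverse q) (qderiv q (poly (P n))) x
       + qH_Sbar q \<alpha> lam j (int n) x * qderiv (inverse q) (poly (P n)) x
       + qH_Tbar q \<alpha> lam j (int n) x * poly (P n) x = 0"
proof -
  interpret q_base q using assms(1,2) by unfold_locales
  \<comment> \<open>The barred coefficients are the unbarred ones at \<open>t = x / q\<close>, where the three regular points become \<open>t\<close>, \<open>q t\<close>, \<open>q\<^sup>2 t\<close>.\<close>
  define t where "t = inverse q * x"
  have x: "x = q * t" using \<open>0 < q\<close> by (simp add: t_def)
  have \<alpha>: "\<alpha> \<noteq> 0" using \<open>\<alpha> \<notin> {-1..1}\<close> by auto
  have reg: "qsub_power q t \<alpha> (j + 1) \<noteq> 0" "qsub_power q (q * t) \<alpha> (j + 1) \<noteq> 0"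
      "qsub_power q (q * (q * t)) \<alpha> (j + 1) \<noteq> 0"
    using assms(6) unfolding qH_regular_def by (auto simp: t_def[symmetric] x[symmetric])
  let ?D = "qdiff_poly q" and ?K = "qH_kernel_poly q j \<alpha> n" and ?c = "qH_c q \<alpha> lam j (int n)"
  let ?h = "poly (qHermite q (int n)) t" and ?g = "poly (qHermite q (int n - 1)) t"
  let ?E = "\<lambda>F. F q \<alpha> lam j (int n) t"
  have P: "P n = qHermite q (int n) + smult (- ?c) ?K"
    using qH_Sobolev_connection[OF assms(4,5), of n] by simp
  have DP: "?D (P n) = ?D (qHermite q (int n)) + smult (- ?c) (?D ?K)"
    unfolding P by (simp only: qdiff_poly_add[OF q_neq1] qdiff_poly_smult[OF q_neq1])
  have DDP: "?D (?D (P n)) = ?D (?D (qHermite q (int n))) + smult (- ?c) (?D (?D ?K))"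
    unfolding DP by (simp only: qdiff_poly_add[OF q_neq1] qdiff_poly_smult[OF q_neq1])
  note D_H = qdiff_poly_qHermite
  have f: "poly (P n) t = ?E qH_E1 * ?h + ?E qH_F1 * ?g"
    unfolding P qH_E1_def qH_F1_def
    using qH_kernel_representation[OF reg(1), of n] by (simp add: algebra_simps)
  \<comment> \<open>For \<open>n = 0\<close> the factor \<open>[n - 1]\<^sub>q / \<gamma>\<^sub>n\<^sub>-\<^sub>1\<close> is not \<open>0\<close>, but it multiplies coefficients that all vanish.\<close>
  have index_0: "qH_C1 q j 0 s y = 0" "qH_D1 q j 0 s y = 0" "qH_C2 q j 0 s y = 0" "qH_D2 q j 0 s y = 0" for s y
  proof -
    have A: "qH_A q j 0 = (\<lambda>_ _. 0)" and B: "qH_B q j 0 = (\<lambda>_ _. 0)"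
      by (simp_all add: fun_eq_iff qH_A_def qH_B_def qH_norm2_def)
    have Z: "qderiv q (\<lambda>_. 0) = (\<lambda>_. 0)" by (auto simp: qderiv_def)
    have C: "qH_C1 q j 0 = (\<lambda>_ _. 0)" and D: "qH_D1 q j 0 = (\<lambda>_ _. 0)"
      unfolding qH_C1_def qH_D1_def A B Z by simp_all
    show "qH_C1 q j 0 s y = 0" "qH_D1 q j 0 s y = 0" "qH_C2 q j 0 s y = 0" "qH_D2 q j 0 s y = 0"
      unfolding qH_C2_def qH_D2_def C D Z by simp_all
  qed
  have f1: "poly (?D (P n)) t = ?E qH_E3 * ?h + ?E qH_F3 * ?g"
  proof (cases "n = 0")
    case True
    then show ?thesis
      unfolding DP D_H qH_E3_def qH_F3_def
      using qdiff_poly_const[OF q_neq1, of 0] by (simp add: index_0 qH_kernel_poly_def qnum_def)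
  next
    case False
    then have n: "n \<ge> 1" by simp
    show ?thesis
      unfolding DP D_H qH_E3_def qH_F3_def
      using qdiff_qH_kernel_representation[OF \<alpha> n reg(1,2)] by (simp add: algebra_simps)
  qed
  have f2: "poly (?D (?D (P n))) t = ?E qH_E5 * ?h + ?E qH_F5 * ?g"
  proof (cases "n = 0")
    case True
    then show ?thesis
      unfolding DDP D_H qH_E5_def qH_F5_def
      using qdiff_poly_const[OF q_neq1, of 0]
      by (simp add: index_0 qH_kernel_poly_def qnum_def qfall_Suc numeral_2_eq_2)
  next
    case False
    then have n: "n \<ge> 1" "int n \<ge> 1" by auto
    have "qfall q (int n) 2 = qnum q (int n) * qnum q (int n - 1)"
      by (simp add: qfall_Suc numeral_2_eq_2 qfall_def[of _ _ 0] qpoch_def)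
    then show ?thesis
      unfolding DDP D_H[of "int n"] qdiff_poly_smult[OF q_neq1] qdiff_poly_qHermite_pred[OF n(2)]
        qH_E5_def qH_F5_def
      using qdiff2_qH_kernel_representation[OF \<alpha> n(1) reg]
      by (simp add: algebra_simps diff_divide_distrib)
  qed
  have ode: "?E qH_R * poly (?D (?D (P n))) t + ?E qH_S * poly (?D (P n)) t + ?E qH_T * poly (P n) t = 0"
    unfolding qH_R_def qH_S_def qH_T_def qH_F4_def qH_F6_def qH_E4_def qH_E6_def qH_Xi1_def
    by (rule second_order_elimination[OF f f1 f2])
  \<comment> \<open>The extra term of the second barred coefficient absorbs the difference between \<open>P\<^sub>n(x)\<close> and \<open>P\<^sub>n(t)\<close>.\<close>
  have Px: "poly (P n) x = poly (P n) t + (q - 1) * t * poly (?D (P n)) t"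
    using poly_qdiff_poly[OF q_neq1, of t "P n"] by (simp add: x)
  have D1: "qderiv (inverse q) (poly (P n)) x = poly (?D (P n)) t"
    and D2: "qderiv (inverse q) (qderiv q (poly (P n))) x = poly (?D (?D (P n))) t"
    unfolding x qderiv_poly[OF q_neq1] by (rule qderiv_inverse_poly[OF assms(1,2)])+
  have shift: "(inverse q - 1) * x = - ((q - 1) * t)"
    using \<open>0 < q\<close> by (simp add: x field_simps)
  show ?thesis
    using ode unfolding qH_Rbar_def qH_Sbar_def qH_Tbar_def D1 D2 Px shift t_def[symmetric]
    by (simp add: algebra_simps)
qed

end
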